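(* Let $K$ be a field, $n\geq 2$, $S=K[x_1,\ldots,x_n]$, $\mathbf d:1=d_0\mid d_1\mid\cdots\mid d_s$ a $\mathbf d$-sequence, $\alpha\in\mathbb N$ with $\mathbf d$-decomposition $\alpha=\sum_{t=0}^s\alpha_td_t$, and $I=\langle x_n^{\alpha}\rangle_{\mathbf d}=\prod_{t=0}^s(\mathbf m^{[d_t]})^{\alpha_t}$. Let $q_t=\sum_{j=t}^s\alpha_jd_j$ and $$J=\sum_{0\leq t\leq s,\ \alpha_t>0}(x_1\cdots x_n)^{d_t-1}(\mathbf m^{[d_t]})^{\alpha_t-1}\prod_{j>t}(\mathbf m^{[d_j]})^{\alpha_j}.$$ Then: 1. $\operatorname{Soc}(S/I)=\frac{J+I}{I}$. 2. Let $e$ be a positive integer. Then $\left(\frac{J+I}{I}\right)_e\neq 0$ if and only if $e=q_t+(n-1)(d_t-1)-1$ for some $0\leq t\leq s$ with $\alpha_t>0$. 3. If $\alpha_s\neq 0$, then $\max\{e:\left(\frac{J+I}{I}\right)_e\neq 0\}=\alpha_sd_s+(n-1)(d_s-1)-1$.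
   Context: A $\mathbf d$-sequence is a strictly increasing sequence of positive integers $1=d_0\mid d_1\mid\cdots\mid d_s$, each dividing the next. Every $a\in\mathbb N$ has a unique $\mathbf d$-decomposition $a=\sum_{t=0}^s a_td_t$ with integers $a_t\geq 0$ and $a_t<d_{t+1}/d_t$ for $0\leq t<s$; write $a\leq_{\mathbf d}b$ if $a_t\leq b_t$ for all $t$ in the $\mathbf d$-decompositions. A monomial ideal $I\subset S$ is $\mathbf d$-fixed if for every monomial $v\in I$, all $1\leq j<i\leq n$ and every $t\leq_{\mathbf d}\nu_i(v)$ ($\nu_i(v)$ the exponent of $x_i$ in $v$), one has $v\,x_j^t/x_i^t\in I$. $\langle u\rangle_{\mathbf d}$ is the smallest $\mathbf d$-fixed ideal containing the monomial $u$. $\mathbf m=\{x_1,\ldots,x_n\}$ and $\mathbf m^{[d]}=\{x_1^d,\ldots,x_n^d\}$; in products and powers a set of monomials stands for the ideal it generates. $\operatorname{Soc}(S/I)=(0:_{S/I}(x_1,\ldots,x_n))$, and the subscript $e$ denotes the degree $e$ graded component. *)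

theory Defs
  imports "HOL-Library.Poly_Mapping" "HOL-Library.Cardinality"
    "HOL-Algebra.QuotRing" "HOL-Algebra.Ideal_Product"
begin

section \<open>Arithmetic with respect to a d-sequence\<close>

definition d_sequence :: "nat \<Rightarrow> (nat \<Rightarrow> nat) \<Rightarrow> bool" where
  "d_sequence s d \<longleftrightarrow> d 0 = 1 \<and> (\<forall>t<s. d t < d (Suc t) \<and> d t dvd d (Suc t))"

definition d_decomposition :: "nat \<Rightarrow> (nat \<Rightarrow> nat) \<Rightarrow> nat \<Rightarrow> (nat \<Rightarrow> nat) \<Rightarrow> bool" where
  "d_decomposition s d a c \<longleftrightarrow>
     a = (\<Sum>t\<le>s. c t * d t) \<and> (\<forall>t<s. c t < d (Suc t) div d t)"

definition d_le :: "nat \<Rightarrow> (nat \<Rightarrow> nat) \<Rightarrow> nat \<Rightarrow> nat \<Rightarrow> bool" where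
  "d_le s d a b \<longleftrightarrow>
     (\<exists>a' b'. d_decomposition s d a a' \<and> d_decomposition s d b b' \<and> (\<forall>t\<le>s. a' t \<le> b' t))"


section \<open>The polynomial ring\<close>

text \<open>
  The variables are indexed by a finite linear order \<open>'n\<close> (so the number of variables is
  \<open>CARD('n)\<close>, and the last variable has index \<open>Max UNIV\<close>); a polynomial is a finitely
  supported function from exponent vectors to coefficients.
\<close>

type_synonym ('n, 'k) mpoly = "('n \<Rightarrow>\<^sub>0 nat) \<Rightarrow>\<^sub>0 'k"

definition poly_ring :: "('n, 'k::field) mpoly ring" where
  "poly_ring = \<lparr>carrier = UNIV, mult = (*), one = 1, zero = 0, add = (+)\<rparr>"

definition monom :: "('n \<Rightarrow>\<^sub>0 nat) \<Rightarrow> ('n, 'k::field) mpoly" where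
  "monom v = Poly_Mapping.single v 1"

definition homogeneous :: "nat \<Rightarrow> ('n::finite, 'k::field) mpoly \<Rightarrow> bool" where
  "homogeneous e f \<longleftrightarrow> (\<forall>v\<in>Poly_Mapping.keys f. (\<Sum>i\<in>UNIV. Poly_Mapping.lookup v i) = e)"

definition power_ideal :: "nat \<Rightarrow> ('n, 'k::field) mpoly set" where
  "power_ideal r = Idl\<^bsub>poly_ring\<^esub> (range (\<lambda>i. monom (Poly_Mapping.single i r)))"

definition all_vars :: "('n::finite, 'k::field) mpoly" where
  "all_vars = (\<Prod>i\<in>UNIV. monom (Poly_Mapping.single i 1))"


section \<open>d-fixed ideals\<close>

definition monomial_ideal :: "('n, 'k::field) mpoly set \<Rightarrow> bool" where
  "monomial_ideal I \<longleftrightarrow> (\<exists>M. I = Idl\<^bsub>poly_ring\<^esub> (monom ` M))"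

definition d_fixed :: "nat \<Rightarrow> (nat \<Rightarrow> nat) \<Rightarrow> ('n::linorder, 'k::field) mpoly set \<Rightarrow> bool" where
  "d_fixed s d I \<longleftrightarrow> monomial_ideal I \<and>
     (\<forall>v i j t. monom v \<in> I \<longrightarrow> j < i \<longrightarrow> d_le s d t (Poly_Mapping.lookup v i) \<longrightarrow>
        monom (v + Poly_Mapping.single j t - Poly_Mapping.single i t) \<in> I)"

definition d_fixed_closure ::
    "nat \<Rightarrow> (nat \<Rightarrow> nat) \<Rightarrow> ('n::linorder \<Rightarrow>\<^sub>0 nat) \<Rightarrow> ('n, 'k::field) mpoly set" where
  "d_fixed_closure s d u = (LEAST I. d_fixed s d I \<and> monom u \<in> I)"


section \<open>Socle and graded components of the quotient\<close>

text \<open>A polynomial \<open>f\<close> acts on \<open>S/I\<close> as multiplication by the class of \<open>f\<close>.\<close>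

definition socle :: "('n, 'k::field) mpoly set \<Rightarrow> ('n, 'k) mpoly set set" where
  "socle I = {X \<in> carrier (poly_ring Quot I).
     \<forall>f\<in>power_ideal 1. (I +>\<^bsub>poly_ring\<^esub> f) \<otimes>\<^bsub>poly_ring Quot I\<^esub> X = \<zero>\<^bsub>poly_ring Quot I\<^esub>}"

definition quotient_image ::
    "('n, 'k::field) mpoly set \<Rightarrow> ('n, 'k) mpoly set \<Rightarrow> ('n, 'k) mpoly set set" where
  "quotient_image J I = (\<lambda>f. I +>\<^bsub>poly_ring\<^esub> f) ` (J <+>\<^bsub>poly_ring\<^esub> I)"

definition graded_component ::
    "('n::finite, 'k::field) mpoly set \<Rightarrow> nat \<Rightarrow> ('n, 'k) mpoly set set \<Rightarrow> ('n, 'k) mpoly set set" where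
  "graded_component I e N = N \<inter> {I +>\<^bsub>poly_ring\<^esub> f | f. homogeneous e f}"


section \<open>The ideal J\<close>

text \<open>
  \<^const>\<open>ideals_set\<close> is the semiring of ideals, whose sums, products and powers are those of
  ideals; the empty sum is the zero ideal and the empty product is the whole ring.
\<close>

definition product_ideal ::
    "nat set \<Rightarrow> (nat \<Rightarrow> nat) \<Rightarrow> (nat \<Rightarrow> nat) \<Rightarrow> ('n, 'k::field) mpoly set" where
  "product_ideal T d c =
     finprod (ideals_set poly_ring) (\<lambda>t. power_ideal (d t) [^]\<^bsub>ideals_set poly_ring\<^esub> c t) T"

definition socle_ideal ::
    "nat \<Rightarrow> (nat \<Rightarrow> nat) \<Rightarrow> (nat \<Rightarrow> nat) \<Rightarrow> ('n::finite, 'k::field) mpoly set" where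
  "socle_ideal s d c =
     finsum (ideals_set poly_ring)
       (\<lambda>t. Idl\<^bsub>poly_ring\<^esub> {all_vars ^ (d t - 1)}
            \<otimes>\<^bsub>ideals_set poly_ring\<^esub> (power_ideal (d t) [^]\<^bsub>ideals_set poly_ring\<^esub> (c t - 1))
            \<otimes>\<^bsub>ideals_set poly_ring\<^esub> product_ideal {t<..s} d c)
       {t. t \<le> s \<and> c t > 0}"

end

theory Submission
  imports Defs
begin

text \<open>
  All ideals involved are monomial, so the statement is about sets of exponent vectors. A monomial
  \<open>x\<^sup>v\<close> lies in the product of the powers \<open>\<alpha> t\<close> of the ideals generated by the \<open>d t\<close>-th powers of the
  variables if and only if \<open>\<alpha> t\<close> tokens of size \<open>d t\<close>, for every \<open>t\<close>, can be distributed to the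
  variables so that the tokens given to \<open>x\<^sub>i\<close> have total size at most \<open>v\<^sub>i\<close>. Since the sizes divide
  each other, a greedy placement from the largest size downwards shows that this is possible if and
  only if, for all \<open>t\<close>, \<open>q\<^sub>t \<le> \<Sum>i. d t * (v\<^sub>i div d t)\<close>, where \<open>q\<^sub>t\<close> is the total size of the tokens
  of sizes \<open>d t, \<dots>, d s\<close> (lemma \<open>token_exps_iff\<close>). Everything follows from this criterion.

  The product is \<open>d\<close>-fixed, because subtraction of \<open>t\<close> from an exponent whose digits dominate those
  of \<open>t\<close> is compatible with rounding down to multiples of \<open>d l\<close> (\<open>token_exps_d_fixed\<close>). It is the
  smallest such ideal containing the power of the last variable, because each token distribution
  is reached from that power by moving the tokens of one variable after the other
  (\<open>product_ideal_subset_d_fixed\<close>).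

  If \<open>x\<^sup>v\<close> is outside \<open>I\<close> but all \<open>x\<^sub>i x\<^sup>v\<close> are inside, the largest level \<open>t\<close> at which the criterion
  fails is repaired by increasing any one exponent by one. Hence all \<open>v\<^sub>i\<close> are \<open>d t - 1\<close> modulo \<open>d t\<close>
  and one token of size \<open>d t\<close> is missing, which says that \<open>x\<^sup>v\<close> lies in the \<open>t\<close>-th summand of \<open>J\<close>
  (\<open>colon_subset_socle_exps\<close>). Conversely, multiplying an element of that summand by \<open>x\<^sub>i\<close> supplies the
  missing token, and the smaller tokens fit into the \<open>d t - 1\<close> at another variable
  (\<open>socle_exps_colon\<close>). In particular \<open>J\<close> modulo \<open>I\<close> is spanned by generators of \<open>J\<close>; those of the
  \<open>t\<close>-th summand have one common degree, and one of them is outside \<open>I\<close>. These degrees are largest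
  for \<open>t = s\<close>.
\<close>

section \<open>Monomial ideals as sets of exponents\<close>

lemma poly_ring_simps [simp]:
  "carrier poly_ring = UNIV" "x \<otimes>\<^bsub>poly_ring\<^esub> y = x * y" "x \<oplus>\<^bsub>poly_ring\<^esub> y = x + y"
  "\<one>\<^bsub>poly_ring\<^esub> = 1" "\<zero>\<^bsub>poly_ring\<^esub> = 0"
  by (simp_all add: poly_ring_def)

lemma cring_poly_ring: "cring (poly_ring :: ('n, 'k::field) mpoly ring)"
proof (rule cringI)
  show "abelian_group (poly_ring :: ('n, 'k) mpoly ring)"
    by (rule abelian_groupI) (auto simp: algebra_simps intro: exI[of _ "- _"] add.right_inverse)
  show "comm_monoid (poly_ring :: ('n, 'k) mpoly ring)"
    by (rule comm_monoidI) (auto simp: algebra_simps)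
qed (simp add: algebra_simps)

interpretation PR: cring "poly_ring :: ('n, 'k::field) mpoly ring"
  by (rule cring_poly_ring)

lemma a_inv_poly_ring [simp]: "\<ominus>\<^bsub>poly_ring\<^esub> f = - (f :: ('n, 'k::field) mpoly)"
  by (rule PR.minus_equality) simp_all

lemma keys_monom [simp]: "Poly_Mapping.keys (monom v :: ('n, 'k::field) mpoly) = {v}"
  by (simp add: monom_def)

lemma monom_add: "monom (v + w) = monom v * (monom w :: ('n, 'k::field) mpoly)"
  by (simp add: monom_def mult_single)

lemma monom_zero: "monom 0 = (1 :: ('n, 'k::field) mpoly)"
  by (simp add: monom_def)

lemma update_eq_add:
  assumes "v \<notin> Poly_Mapping.keys f"
  shows "Poly_Mapping.update v c f = Poly_Mapping.single v c + f"
  using assms by (intro poly_mapping_eqI)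
    (auto simp: lookup_update lookup_add lookup_single when_def in_keys_iff)

text \<open>Multiplication by a monomial only shifts the coefficients, so no cancellation occurs.\<close>

lemma lookup_monom_mult:
  "Poly_Mapping.lookup (monom u * f) (u + v) = Poly_Mapping.lookup (f :: ('n, 'k::field) mpoly) v"
proof (induction f rule: update_induct)
  case (update f w c)
  then show ?case
    by (simp add: update_eq_add distrib_left monom_def mult_single lookup_add lookup_single when_def)
qed simp

text \<open>
  Exponent sets closed under adding arbitrary exponents are the ideals of the monoid of monomials;
  they correspond bijectively to the monomial ideals of the polynomial ring.
\<close>

definition up_closed :: "('n \<Rightarrow>\<^sub>0 nat) set \<Rightarrow> bool" where
  "up_closed A \<longleftrightarrow> (\<forall>v\<in>A. \<forall>w. v + w \<in> A)"

text \<open>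
  The polynomials all of whose monomials have exponents in \<open>A\<close>: for up-closed \<open>A\<close>, the monomial
  ideal with exponent set \<open>A\<close>.
\<close>

definition supp_ideal :: "('n \<Rightarrow>\<^sub>0 nat) set \<Rightarrow> ('n, 'k::field) mpoly set" where
  "supp_ideal A = {f. Poly_Mapping.keys f \<subseteq> A}"

lemma up_closedD: "up_closed A \<Longrightarrow> v \<in> A \<Longrightarrow> v + w \<in> A"
  by (simp add: up_closed_def)

lemma monom_in_supp_ideal [simp]: "monom v \<in> supp_ideal A \<longleftrightarrow> v \<in> A"
  by (simp add: supp_ideal_def)

lemma ideal_supp_ideal:
  assumes "up_closed A"
  shows "ideal (supp_ideal A :: ('n, 'k::field) mpoly set) poly_ring"
proof (rule idealI)
  show "ring (poly_ring :: ('n, 'k) mpoly ring)"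
    by (rule PR.ring_axioms)
  show "subgroup (supp_ideal A :: ('n, 'k) mpoly set) (add_monoid poly_ring)"
  proof (rule PR.add.subgroupI)
    show "(supp_ideal A :: ('n, 'k) mpoly set) \<noteq> {}"
      by (auto simp: supp_ideal_def intro: exI[of _ 0])
  next
    fix f :: "('n, 'k) mpoly"
    assume "f \<in> supp_ideal A"
    then have "- f \<in> supp_ideal A"
      by (auto simp: supp_ideal_def in_keys_iff)
    then show "\<ominus>\<^bsub>poly_ring\<^esub> f \<in> supp_ideal A"
      by simp
  next
    fix f g :: "('n, 'k) mpoly"
    assume "f \<in> supp_ideal A" "g \<in> supp_ideal A"
    then show "f \<oplus>\<^bsub>poly_ring\<^esub> g \<in> supp_ideal A"
      using Poly_Mapping.keys_add[of f g] by (auto simp: supp_ideal_def)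
  qed simp
  fix f g :: "('n, 'k) mpoly"
  assume "f \<in> supp_ideal A"
  then show "g \<otimes>\<^bsub>poly_ring\<^esub> f \<in> supp_ideal A" "f \<otimes>\<^bsub>poly_ring\<^esub> g \<in> supp_ideal A"
    using keys_mult[of g f] assms by (fastforce simp: supp_ideal_def up_closed_def ac_simps)+
qed

text \<open>Inclusion of a monomial ideal into an arbitrary ideal is decided on monomials.\<close>

lemma supp_ideal_subset_iff:
  assumes "ideal I (poly_ring :: ('n, 'k::field) mpoly ring)"
  shows "supp_ideal A \<subseteq> I \<longleftrightarrow> monom ` A \<subseteq> I"
proof
  interpret ideal I poly_ring by fact
  assume A: "monom ` A \<subseteq> I"
  have "Poly_Mapping.keys f \<subseteq> A \<longrightarrow> f \<in> I" for f :: "('n, 'k) mpoly"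
  proof (induction f rule: update_induct)
    case const
    show ?case using zero_closed by simp
  next
    case (update f v c)
    have eq: "Poly_Mapping.update v c f = Poly_Mapping.single 0 c * monom v + f"
      using update.hyps by (simp add: update_eq_add monom_def mult_single)
    show ?case
    proof
      assume keys: "Poly_Mapping.keys (Poly_Mapping.update v c f) \<subseteq> A"
      with update have "f \<in> I" "v \<in> A"
        by (auto simp: keys_update)
      then show "Poly_Mapping.update v c f \<in> I"
        unfolding eq using A a_closed I_l_closed by (auto simp flip: poly_ring_simps(2,3))
    qed
  qed
  then show "supp_ideal A \<subseteq> I"
    by (auto simp: supp_ideal_def)
qed (auto simp: image_subset_iff)

lemma Idl_monom:
  "Idl\<^bsub>poly_ring\<^esub> (monom ` M) = (supp_ideal {g + w | g w. g \<in> M} :: ('n, 'k::field) mpoly set)"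
proof
  have "up_closed {g + w | g w. g \<in> M}"
    by (force simp: up_closed_def ac_simps)
  then show "Idl\<^bsub>poly_ring\<^esub> (monom ` M) \<subseteq> (supp_ideal {g + w | g w. g \<in> M} :: ('n, 'k) mpoly set)"
    by (intro PR.genideal_minimal ideal_supp_ideal) (auto, metis add.right_neutral)
  interpret ideal "Idl\<^bsub>poly_ring\<^esub> (monom ` M) :: ('n, 'k) mpoly set" poly_ring
    by (intro PR.genideal_ideal) simp
  have "monom v \<in> (Idl\<^bsub>poly_ring\<^esub> (monom ` M) :: ('n, 'k) mpoly set)" if "v \<in> M" for v
    using that PR.genideal_self[of "monom ` M"] by auto
  then show "(supp_ideal {g + w | g w. g \<in> M} :: ('n, 'k) mpoly set) \<subseteq> Idl\<^bsub>poly_ring\<^esub> (monom ` M)"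
    unfolding supp_ideal_subset_iff[OF is_ideal]
    using I_r_closed by (auto simp: monom_add)
qed

lemma Idl_monom_up_closed:
  assumes "up_closed A"
  shows "Idl\<^bsub>poly_ring\<^esub> (monom ` A) = (supp_ideal A :: ('n, 'k::field) mpoly set)"
proof -
  have "{g + w | g w. g \<in> A} = A"
    using assms by (auto simp: up_closed_def) (metis add.right_neutral)
  then show ?thesis
    by (simp add: Idl_monom)
qed

lemma ideal_prod_supp_ideal:
  assumes "up_closed A" "up_closed B"
  shows "up_closed {v + w | v w. v \<in> A \<and> w \<in> B}" (is "up_closed ?AB")
    and "ideal_prod poly_ring (supp_ideal A) (supp_ideal B) =
      (supp_ideal {v + w | v w. v \<in> A \<and> w \<in> B} :: ('n, 'k::field) mpoly set)"
proof -
  show up: "up_closed ?AB"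
    using assms unfolding up_closed_def by clarify (metis add.assoc)
  note ideals = ideal_supp_ideal[OF assms(1)] ideal_supp_ideal[OF assms(2)]
  show "ideal_prod poly_ring (supp_ideal A) (supp_ideal B) = (supp_ideal ?AB :: ('n, 'k) mpoly set)"
  proof
    show "(supp_ideal ?AB :: ('n, 'k) mpoly set) \<subseteq> ideal_prod poly_ring (supp_ideal A) (supp_ideal B)"
      unfolding supp_ideal_subset_iff[OF PR.ideal_prod_is_ideal[OF ideals]]
      by (auto simp: monom_add intro!: ideal_prod.prod[where R = poly_ring, simplified])
  next
    interpret AB: ideal "supp_ideal ?AB :: ('n, 'k) mpoly set" poly_ring
      by (rule ideal_supp_ideal[OF up])
    have "f \<in> supp_ideal ?AB"
      if "f \<in> ideal_prod poly_ring (supp_ideal A) (supp_ideal B)" for f :: "('n, 'k) mpoly"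
      using that
    proof induction
      case (prod f g)
      then show ?case
        using keys_mult[of f g] by (fastforce simp: supp_ideal_def)
    next
      case (sum f g)
      then show ?case using AB.a_closed by simp
    qed
    then show "ideal_prod poly_ring (supp_ideal A) (supp_ideal B) \<subseteq> (supp_ideal ?AB :: ('n, 'k) mpoly set)"
      by blast
  qed
qed

lemma up_closed_UN: "(\<And>t. t \<in> T \<Longrightarrow> up_closed (A t)) \<Longrightarrow> up_closed (\<Union>t\<in>T. A t)"
  by (auto simp: up_closed_def)

lemma up_closed_Un: "up_closed A \<Longrightarrow> up_closed B \<Longrightarrow> up_closed (A \<union> B)"
  by (auto simp: up_closed_def)

lemma set_add_supp_ideal:
  assumes "up_closed A" "up_closed B"
  shows "supp_ideal A <+>\<^bsub>poly_ring\<^esub> supp_ideal B = (supp_ideal (A \<union> B) :: ('n, 'k::field) mpoly set)"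
proof
  note ideals = ideal_supp_ideal[OF assms(1)] ideal_supp_ideal[OF assms(2)]
  have "f + g \<in> supp_ideal A <+>\<^bsub>poly_ring\<^esub> supp_ideal B"
    if "f \<in> supp_ideal A" "g \<in> supp_ideal B" for f g :: "('n, 'k) mpoly"
    using that unfolding set_add_def' by auto
  from this[of "monom _" 0] this[of 0 "monom _"]
  show "(supp_ideal (A \<union> B) :: ('n, 'k) mpoly set) \<subseteq> supp_ideal A <+>\<^bsub>poly_ring\<^esub> supp_ideal B"
    unfolding supp_ideal_subset_iff[OF PR.add_ideals[OF ideals]] by (auto simp: supp_ideal_def)
  show "supp_ideal A <+>\<^bsub>poly_ring\<^esub> supp_ideal B \<subseteq> (supp_ideal (A \<union> B) :: ('n, 'k) mpoly set)"
    unfolding set_add_def' using Poly_Mapping.keys_add by (fastforce simp: supp_ideal_def)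
qed

lemma ideals_set_simps:
  "carrier (ideals_set R) = {I. ideal I R}" "\<one>\<^bsub>ideals_set R\<^esub> = carrier R"
  "\<zero>\<^bsub>ideals_set R\<^esub> = {\<zero>\<^bsub>R\<^esub>}" "I \<otimes>\<^bsub>ideals_set R\<^esub> J = ideal_prod R I J"
  "I \<oplus>\<^bsub>ideals_set R\<^esub> J = I <+>\<^bsub>R\<^esub> J"
  by (simp_all add: ideals_set_def)

interpretation PI: comm_monoid "ideals_set (poly_ring :: ('n, 'k::field) mpoly ring)"
  by (rule PR.ideals_set_is_comm_monoid)

interpretation PS: semiring "ideals_set (poly_ring :: ('n, 'k::field) mpoly ring)"
  by (rule PR.ideals_set_is_semiring)

lemma finsum_supp_ideal:
  assumes "finite T" "\<And>t. t \<in> T \<Longrightarrow> up_closed (A t)"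
  shows "finsum (ideals_set poly_ring) (\<lambda>t. supp_ideal (A t)) T =
    (supp_ideal (\<Union>t\<in>T. A t) :: ('n, 'k::field) mpoly set)"
  using assms
proof (induction T rule: finite_induct)
  case empty
  then show ?case by (simp add: ideals_set_simps supp_ideal_def)
next
  case (insert t T)
  have "up_closed (\<Union>t\<in>T. A t)"
    using insert.prems by (intro up_closed_UN) simp
  with insert show ?case
    by (subst PS.finsum_insert)
      (auto simp: ideals_set_simps ideal_supp_ideal set_add_supp_ideal)
qed


section \<open>Exponents of products of ideals generated by pure powers\<close>

text \<open>
  Exponents of the \<open>c\<close>-th power of the ideal generated by the \<open>r\<close>-th powers of the variables:
  \<open>k i\<close> is the number of factors \<open>x\<^sub>i\<^sup>r\<close> used.
\<close>

definition power_exps :: "nat \<Rightarrow> nat \<Rightarrow> ('n::finite \<Rightarrow>\<^sub>0 nat) set" where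
  "power_exps r c = {v. \<exists>k. (\<Sum>i\<in>UNIV. k i) = c \<and> (\<forall>i. k i * r \<le> Poly_Mapping.lookup v i)}"

text \<open>
  Exponents of the product over \<open>t \<in> T\<close> of the \<open>c t\<close>-th powers of the ideals generated by the
  \<open>d t\<close>-th powers of the variables. A factor \<open>x\<^sub>i\<close> raised to \<open>d t\<close> is a token of size \<open>d t\<close> placed
  at \<open>i\<close>; the matrix \<open>k\<close> records how many tokens of each size are placed at each variable, and the
  tokens placed at \<open>i\<close> have to fit into the exponent of \<open>x\<^sub>i\<close>.
\<close>

definition token_exps :: "nat set \<Rightarrow> (nat \<Rightarrow> nat) \<Rightarrow> (nat \<Rightarrow> nat) \<Rightarrow> ('n::finite \<Rightarrow>\<^sub>0 nat) set" where
  "token_exps T d c =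
     {v. \<exists>k. (\<forall>t\<in>T. (\<Sum>i\<in>UNIV. k t i) = c t) \<and> (\<forall>i. (\<Sum>t\<in>T. k t i * d t) \<le> Poly_Mapping.lookup v i)}"

lemma token_expsI:
  assumes "\<And>t. t \<in> T \<Longrightarrow> (\<Sum>i\<in>UNIV. k t i) = c t"
    and "\<And>i. (\<Sum>t\<in>T. k t i * d t) \<le> Poly_Mapping.lookup v i"
  shows "v \<in> token_exps T d c"
  using assms unfolding token_exps_def by blast

lemma up_closed_power_exps: "up_closed (power_exps r c)"
  by (auto simp: up_closed_def power_exps_def lookup_add intro: trans_le_add1)

lemma up_closed_token_exps: "up_closed (token_exps T d c)"
  by (fastforce simp: up_closed_def token_exps_def lookup_add intro: trans_le_add1)

lemma power_exps_Suc:
  "{v + w | v w. v \<in> power_exps r c \<and> w \<in> {w. \<exists>i. r \<le> Poly_Mapping.lookup w i}} =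
   (power_exps r (Suc c) :: ('n::finite \<Rightarrow>\<^sub>0 nat) set)" (is "?L = ?R")
proof (intro subset_antisym subsetI)
  fix u :: "'n \<Rightarrow>\<^sub>0 nat"
  assume "u \<in> ?L"
  then obtain v i w k where u: "u = v + w" "r \<le> Poly_Mapping.lookup w i"
    and k: "(\<Sum>i\<in>UNIV. k i) = c" "\<And>i. k i * r \<le> Poly_Mapping.lookup v i"
    unfolding power_exps_def by blast
  have "(\<Sum>j\<in>UNIV. k j + (if j = i then 1 else 0)) = Suc c"
    using k(1) by (simp add: sum.distrib)
  moreover have "(k j + (if j = i then 1 else 0)) * r \<le> Poly_Mapping.lookup u j" for j
    using k(2)[of j] u(2) by (auto simp: u(1) lookup_add algebra_simps intro: add_mono)
  ultimately show "u \<in> ?R"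
    unfolding power_exps_def by blast
next
  fix u :: "'n \<Rightarrow>\<^sub>0 nat"
  assume "u \<in> ?R"
  then obtain k where k: "(\<Sum>i\<in>UNIV. k i) = Suc c" "\<And>i. k i * r \<le> Poly_Mapping.lookup u i"
    unfolding power_exps_def by blast
  from k(1) obtain i where i: "k i > 0"
    by (metis bot_nat_0.not_eq_extremum nat.simps(3) sum.neutral)
  have le: "r \<le> Poly_Mapping.lookup u i"
    using k(2)[of i] i by (metis One_nat_def Suc_leI le_trans mult_le_mono1 nat_mult_1)
  have "(\<Sum>j\<in>UNIV. (k(i := k i - 1)) j) = c"
    using k(1) i by (simp add: sum.remove[of UNIV i] del: fun_upd_apply) (simp add: sum.If_cases)
  moreover have "(k(i := k i - 1)) j * r \<le> Poly_Mapping.lookup (u - Poly_Mapping.single i r) j" for j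
    using k(2)[of j] by (auto simp: lookup_minus lookup_single when_def diff_mult_distrib)
  ultimately have "u - Poly_Mapping.single i r \<in> power_exps r c"
    unfolding power_exps_def by blast
  moreover have "u = (u - Poly_Mapping.single i r) + Poly_Mapping.single i r"
    using le by (intro poly_mapping_eqI) (auto simp: lookup_add lookup_minus lookup_single when_def)
  moreover have "Poly_Mapping.single i r \<in> {w. \<exists>i. r \<le> Poly_Mapping.lookup w i}"
    by (auto intro: exI[of _ i])
  ultimately show "u \<in> ?L"
    by blast
qed

lemma power_ideal_eq:
  "power_ideal r = (supp_ideal {w. \<exists>i. r \<le> Poly_Mapping.lookup w i} :: ('n, 'k::field) mpoly set)"
proof -
  have "power_ideal r = Idl\<^bsub>poly_ring\<^esub> (monom ` (range (\<lambda>i. Poly_Mapping.single i r)) :: ('n, 'k) mpoly set)"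
    by (simp add: power_ideal_def image_image)
  also note Idl_monom
  also have "{g + w | g w. g \<in> range (\<lambda>i :: 'n. Poly_Mapping.single i r)} = {w. \<exists>i. r \<le> Poly_Mapping.lookup w i}"
  proof (intro subset_antisym subsetI)
    fix w :: "'n \<Rightarrow>\<^sub>0 nat"
    assume "w \<in> {w. \<exists>i. r \<le> Poly_Mapping.lookup w i}"
    then obtain i where "r \<le> Poly_Mapping.lookup w i"
      by blast
    then have "w = Poly_Mapping.single i r + (w - Poly_Mapping.single i r)"
      by (intro poly_mapping_eqI) (auto simp: lookup_add lookup_minus lookup_single when_def)
    then show "w \<in> {g + w | g w. g \<in> range (\<lambda>i. Poly_Mapping.single i r)}"
      by blast
  qed (auto simp: lookup_add, metis le_add1 lookup_single_eq)
  finally show ?thesis .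
qed

lemma up_closed_single: "up_closed {w. \<exists>i. r \<le> Poly_Mapping.lookup w i}"
  by (auto simp: up_closed_def lookup_add intro: trans_le_add1)

lemma power_ideal_pow:
  "power_ideal r [^]\<^bsub>ideals_set poly_ring\<^esub> c = (supp_ideal (power_exps r c) :: ('n::finite, 'k::field) mpoly set)"
proof (induction c)
  case 0
  have "power_exps r 0 = (UNIV :: ('n \<Rightarrow>\<^sub>0 nat) set)"
    by (auto simp: power_exps_def intro: exI[of _ "\<lambda>_. 0"])
  then show ?case
    by (simp add: ideals_set_simps supp_ideal_def)
next
  case (Suc c)
  then show ?case
    by (simp add: ideals_set_simps power_ideal_eq ideal_prod_supp_ideal up_closed_power_exps
        up_closed_single flip: power_exps_Suc)
qed

lemma token_exps_insert:
  assumes "finite T" "t \<notin> T"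
  shows "{v + w | v w. v \<in> power_exps (d t) (c t) \<and> w \<in> token_exps T d c} =
    (token_exps (insert t T) d c :: ('n::finite \<Rightarrow>\<^sub>0 nat) set)" (is "?L = ?R")
proof (intro subset_antisym subsetI)
  fix u :: "'n \<Rightarrow>\<^sub>0 nat"
  assume "u \<in> ?L"
  then obtain v w k l where u: "u = v + w"
    and k: "(\<Sum>i\<in>UNIV. k i) = c t" "\<And>i. k i * d t \<le> Poly_Mapping.lookup v i"
    and l: "\<And>t. t \<in> T \<Longrightarrow> (\<Sum>i\<in>UNIV. l t i) = c t"
      "\<And>i. (\<Sum>t\<in>T. l t i * d t) \<le> Poly_Mapping.lookup w i"
    unfolding power_exps_def token_exps_def by blast
  have eq: "(\<Sum>r\<in>T. (l(t := k)) r i * d r) = (\<Sum>r\<in>T. l r i * d r)" for i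
    using assms by (intro sum.cong) auto
  have "(\<Sum>r\<in>insert t T. (l(t := k)) r i * d r) \<le> Poly_Mapping.lookup u i" for i
    using assms k(2)[of i] l(2)[of i] eq[of i] by (simp add: u lookup_add)
  moreover have "\<forall>r\<in>insert t T. (\<Sum>i\<in>UNIV. (l(t := k)) r i) = c r"
    using k(1) l(1) by auto
  ultimately show "u \<in> ?R"
    unfolding token_exps_def by blast
next
  fix u :: "'n \<Rightarrow>\<^sub>0 nat"
  assume "u \<in> ?R"
  then obtain k where k: "\<And>r. r \<in> insert t T \<Longrightarrow> (\<Sum>i\<in>UNIV. k r i) = c r"
      "\<And>i. (\<Sum>r\<in>insert t T. k r i * d r) \<le> Poly_Mapping.lookup u i"
    unfolding token_exps_def by blast
  define v where "v = Abs_poly_mapping (\<lambda>i. k t i * d t)"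
  have v: "Poly_Mapping.lookup v i = k t i * d t" for i
    by (simp add: v_def)
  have le: "k t i * d t + (\<Sum>r\<in>T. k r i * d r) \<le> Poly_Mapping.lookup u i" for i
    using k(2)[of i] assms by simp
  have "v \<in> power_exps (d t) (c t)"
    using k(1)[of t] by (auto simp: power_exps_def v)
  moreover have "(\<Sum>r\<in>T. k r i * d r) \<le> Poly_Mapping.lookup (u - v) i" for i
    using le[of i] by (simp add: v lookup_minus)
  then have "u - v \<in> token_exps T d c"
    using k(1) unfolding token_exps_def by blast
  moreover have "u = v + (u - v)"
    using add_leD1[OF le] by (intro poly_mapping_eqI) (simp add: lookup_add lookup_minus v)
  ultimately show "u \<in> ?L"
    by blast
qed

lemma product_ideal_eq:
  assumes "finite T"
  shows "product_ideal T d c = (supp_ideal (token_exps T d c) :: ('n::finite, 'k::field) mpoly set)"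
  using assms
proof (induction T rule: finite_induct)
  case empty
  have "token_exps {} d c = (UNIV :: ('n \<Rightarrow>\<^sub>0 nat) set)"
    by (simp add: token_exps_def)
  then show ?case
    by (simp add: product_ideal_def ideals_set_simps supp_ideal_def)
next
  case (insert t T)
  have "product_ideal (insert t T) d c =
      ideal_prod poly_ring (power_ideal (d t) [^]\<^bsub>ideals_set poly_ring\<^esub> c t) (product_ideal T d c :: ('n, 'k) mpoly set)"
    using insert.hyps unfolding product_ideal_def
    by (subst PI.finprod_insert)
      (auto simp: power_ideal_pow ideals_set_simps ideal_supp_ideal up_closed_power_exps)
  also have "\<dots> = supp_ideal (token_exps (insert t T) d c)"
    using insert by (simp add: power_ideal_pow ideal_prod_supp_ideal up_closed_power_exps
        up_closed_token_exps token_exps_insert)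
  finally show ?case .
qed


section \<open>Arithmetic of d-sequences\<close>

lemma d_sequence_dvd:
  assumes "d_sequence s d" "t \<le> j" "j \<le> s"
  shows "d t dvd d j"
  using assms(2,3)
proof (induction j rule: dec_induct)
  case (step j)
  then show ?case
    using assms(1) by (auto simp: d_sequence_def intro: dvd_trans)
qed simp

lemma d_sequence_pos:
  assumes "d_sequence s d" "t \<le> s"
  shows "0 < d t"
  using assms(2)
proof (induction t)
  case (Suc t)
  then show ?case
    using assms(1) by (auto simp: d_sequence_def Suc_le_eq intro: gr_implies_not0)
qed (use assms(1) in \<open>simp add: d_sequence_def\<close>)

text \<open>The digits in the positions \<open>l, \<dots>, t - 1\<close> contribute at most \<open>d t - d l\<close>.\<close>

lemma sum_digits_below:
  assumes "d_sequence s d" "\<And>t. t < s \<Longrightarrow> c t < d (Suc t) div d t" "l \<le> t" "t \<le> s"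
  shows "(\<Sum>j=l..<t. c j * d j) + d l \<le> d t"
  using assms(3,4)
proof (induction t rule: dec_induct)
  case (step t)
  have "d t dvd d (Suc t)"
    using step.prems assms(1) by (auto simp: d_sequence_def)
  moreover have "Suc (c t) \<le> d (Suc t) div d t"
    using assms(2)[of t] step.prems by simp
  ultimately have "Suc (c t) * d t \<le> d (Suc t)"
    by (metis dvd_div_mult_self mult_le_mono1)
  with step show ?case by simp
qed simp

text \<open>
  Here and below, \<open>d * (x div d)\<close> is the largest multiple of \<open>d\<close> not exceeding \<open>x\<close>. For \<open>d = d l\<close>
  it is obtained by deleting the digits of \<open>x\<close> below position \<open>l\<close>.
\<close>

lemma d_decomposition_floor:
  assumes "d_sequence s d" "d_decomposition s d b c" "l \<le> s"
  shows "d l * (b div d l) = (\<Sum>j=l..s. c j * d j)"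
proof -
  have "(\<Sum>j\<le>s. c j * d j) = (\<Sum>j=0..<l. c j * d j) + (\<Sum>j=l..s. c j * d j)"
    using sum.atLeastLessThan_concat[of 0 l "Suc s" "\<lambda>j. c j * d j"] assms(3)
    by (simp add: atLeastLessThanSuc_atLeastAtMost atMost_atLeast0)
  with assms(2) have b: "b = (\<Sum>j=0..<l. c j * d j) + (\<Sum>j=l..s. c j * d j)"
    by (simp add: d_decomposition_def)
  have "(\<Sum>j=0..<l. c j * d j) + d 0 \<le> d l"
    using assms by (intro sum_digits_below[OF assms(1)]) (auto simp: d_decomposition_def)
  then have lt: "(\<Sum>j=0..<l. c j * d j) < d l"
    using assms(1) by (simp add: d_sequence_def)
  have "d l dvd (\<Sum>j=l..s. c j * d j)"
    using assms by (intro dvd_sum dvd_mult) (auto intro: d_sequence_dvd)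
  then obtain q where q: "(\<Sum>j=l..s. c j * d j) = d l * q"
    by (elim dvdE)
  with b lt show ?thesis
    by simp
qed

lemma dvd_le_floor:
  assumes "(d::nat) dvd x" "x \<le> y"
  shows "x \<le> d * (y div d)"
  using assms by (metis div_le_mono dvd_mult_div_cancel mult_le_mono2)

lemma floor_antimono:
  assumes "(d::nat) dvd d'"
  shows "d' * (x div d') \<le> d * (x div d)"
  using assms by (intro dvd_le_floor) auto

lemma pred_add_mult_div: "0 < (d::nat) \<Longrightarrow> (d - 1 + d * k) div d = k"
  by (subst div_mult_self2) simp_all

text \<open>Removing one token of size \<open>d t\<close> lowers the total size by \<open>d t\<close>.\<close>

lemma sum_decrement:
  fixes c d :: "nat \<Rightarrow> nat"
  assumes "t \<le> s" "c t > 0"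
  shows "(\<Sum>l=t..s. (c(t := c t - 1)) l * d l) + d t = (\<Sum>l=t..s. c l * d l)"
proof -
  have "(\<Sum>l=Suc t..s. (c(t := c t - 1)) l * d l) = (\<Sum>l=Suc t..s. c l * d l)"
    by (intro sum.cong) auto
  then show ?thesis
    using assms by (cases "c t") (auto simp: sum.atLeast_Suc_atMost)
qed

lemma floor_add_le: "(d::nat) * (x div d) + d * (y div d) \<le> d * ((x + y) div d)"
  by (metis add_mult_distrib2 div_add1_eq le_add1 mult_le_mono2)

text \<open>If the digits of \<open>t\<close> are at most those of \<open>b\<close>, then \<open>b - t\<close> involves no borrow, so rounding is
  additive.\<close>

lemma d_le_floor_diff:
  assumes "d_sequence s d" "d_le s d t b" "l \<le> s"
  shows "d l * ((b - t) div d l) + d l * (t div d l) = d l * (b div d l)"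
proof -
  obtain t' b' where t': "d_decomposition s d t t'" and b': "d_decomposition s d b b'"
    and le: "\<And>j. j \<le> s \<Longrightarrow> t' j \<le> b' j"
    using assms(2) unfolding d_le_def by blast
  have "b - t = (\<Sum>j\<le>s. b' j * d j - t' j * d j)"
    using t' b' le unfolding d_decomposition_def
    by (subst sum_subtractf_nat) auto
  then have "b - t = (\<Sum>j\<le>s. (b' j - t' j) * d j)"
    by (simp add: diff_mult_distrib)
  moreover have "b' j - t' j < d (Suc j) div d j" if "j < s" for j
    using b' that by (simp add: d_decomposition_def less_imp_diff_less)
  ultimately have "d_decomposition s d (b - t) (\<lambda>j. b' j - t' j)"
    by (simp add: d_decomposition_def)
  from d_decomposition_floor[OF assms(1) this assms(3)]
    d_decomposition_floor[OF assms(1) t' assms(3)] d_decomposition_floor[OF assms(1) b' assms(3)]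
  show ?thesis
    using le by (auto simp flip: sum.distrib intro!: sum.cong)
      (metis add_mult_distrib le_add_diff_inverse2)
qed

section \<open>A numerical criterion for membership in the product\<close>

lemma ex_sum_eq_below:
  fixes m :: "'n \<Rightarrow> nat"
  assumes "finite A" "c \<le> sum m A"
  shows "\<exists>k. sum k A = c \<and> (\<forall>i. k i \<le> m i)"
  using assms(2)
proof (induction c)
  case 0
  show ?case by (intro exI[of _ "\<lambda>_. 0"]) simp
next
  case (Suc c)
  then obtain k where k: "sum k A = c" "\<And>i. k i \<le> m i"
    by auto
  with Suc.prems have "sum k A < sum m A"
    by simp
  then obtain i where i: "i \<in> A" "k i < m i"
    by (meson leI leD sum_mono)
  have "sum (\<lambda>j. k j + (if j = i then 1 else 0)) A = Suc c"
    using k(1) i(1) assms(1) by (simp add: sum.distrib)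
  moreover have "k j + (if j = i then 1 else 0) \<le> m j" for j
    using k(2)[of j] i(2) by auto
  ultimately show ?case by blast
qed

text \<open>
  The criterion: the tokens fit into \<open>v\<close> if and only if, for every level \<open>j\<close> from \<open>t\<close> to \<open>s\<close>,
  the total size of the tokens of size at least \<open>d j\<close> is at most the total room available in
  multiples of \<open>d j\<close>. For sufficiency, tokens are placed greedily from the largest size downwards: whatever has been placed
  before is a multiple of \<open>d t\<close> at each variable, so the room left for tokens of size \<open>d t\<close> depends
  only on the total, not on the placement.
\<close>

lemma token_exps_iff:
  fixes v :: "'n::finite \<Rightarrow>\<^sub>0 nat"
  assumes ds: "d_sequence s d" and t: "t \<le> Suc s"
  shows "v \<in> token_exps {t..s} d c \<longleftrightarrow>
    (\<forall>j\<in>{t..s}. (\<Sum>l=j..s. c l * d l) \<le> (\<Sum>i\<in>UNIV. d j * (Poly_Mapping.lookup v i div d j)))"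
    (is "_ \<longleftrightarrow> (\<forall>j\<in>_. ?q j \<le> ?cap j)")
proof
  assume "v \<in> token_exps {t..s} d c"
  then obtain k where k: "\<And>l. l \<in> {t..s} \<Longrightarrow> (\<Sum>i\<in>UNIV. k l i) = c l"
      "\<And>i. (\<Sum>l=t..s. k l i * d l) \<le> Poly_Mapping.lookup v i"
    unfolding token_exps_def by blast
  show "\<forall>j\<in>{t..s}. ?q j \<le> ?cap j"
  proof
    fix j
    assume j: "j \<in> {t..s}"
    have "?q j = (\<Sum>l=j..s. \<Sum>i\<in>UNIV. k l i * d l)"
      using k(1) j by (auto simp flip: sum_distrib_right intro!: sum.cong)
    also have "\<dots> = (\<Sum>i\<in>UNIV. \<Sum>l=j..s. k l i * d l)"
      by (rule sum.swap)
    also have "\<dots> \<le> ?cap j"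
    proof (rule sum_mono)
      fix i :: 'n
      have "d j dvd (\<Sum>l=j..s. k l i * d l)"
        using ds by (intro dvd_sum dvd_mult) (auto intro: d_sequence_dvd)
      moreover have "(\<Sum>l=j..s. k l i * d l) \<le> Poly_Mapping.lookup v i"
        using j by (intro order.trans[OF sum_mono2 k(2)]) auto
      ultimately show "(\<Sum>l=j..s. k l i * d l) \<le> d j * (Poly_Mapping.lookup v i div d j)"
        by (rule dvd_le_floor)
    qed
    finally show "?q j \<le> ?cap j" .
  qed
next
  assume "\<forall>j\<in>{t..s}. ?q j \<le> ?cap j"
  with t show "v \<in> token_exps {t..s} d c"
  proof (induction t rule: inc_induct)
    case base
    then show ?case by (simp add: token_exps_def)
  next
    case (step t)
    then have ts: "t \<le> s" and "v \<in> token_exps {Suc t..s} d c"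
      by auto
    then obtain k where k: "\<And>l. l \<in> {Suc t..s} \<Longrightarrow> (\<Sum>i\<in>UNIV. k l i) = c l"
        "\<And>i. (\<Sum>l=Suc t..s. k l i * d l) \<le> Poly_Mapping.lookup v i"
      unfolding token_exps_def by blast
    \<comment> \<open>\<open>u i\<close> is the room at \<open>i\<close> taken by the tokens of size larger than \<open>d t\<close>\<close>
    define u where "u i = (\<Sum>l=Suc t..s. k l i * d l)" for i
    have dvd: "d t dvd u i" for i
      unfolding u_def using ds by (intro dvd_sum dvd_mult) (auto intro: d_sequence_dvd)
    have "(\<Sum>i\<in>UNIV. u i) = (\<Sum>l=Suc t..s. \<Sum>i\<in>UNIV. k l i * d l)"
      unfolding u_def by (rule sum.swap)
    also have "\<dots> = ?q (Suc t)"
      using k(1) by (auto simp flip: sum_distrib_right intro!: sum.cong)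
    finally have sum_u: "(\<Sum>i\<in>UNIV. u i) = ?q (Suc t)" .
    have floor: "d t * ((Poly_Mapping.lookup v i - u i) div d t) + u i =
        d t * (Poly_Mapping.lookup v i div d t)" for i
    proof -
      obtain r where r: "u i = d t * r"
        using dvd[of i] by (elim dvdE)
      have "u i \<le> Poly_Mapping.lookup v i"
        using k(2)[of i] by (simp add: u_def)
      then obtain y where y: "Poly_Mapping.lookup v i = y + d t * r"
        by (metis le_add_diff_inverse2 r)
      show ?thesis
        using d_sequence_pos[OF ds ts] by (simp add: y r distrib_left)
    qed
    have "c t * d t + ?q (Suc t) = ?q t"
      using ts by (simp add: sum.atLeast_Suc_atMost)
    also have "\<dots> \<le> ?cap t"
      using step.prems ts by auto
    also have "\<dots> = d t * (\<Sum>i\<in>UNIV. (Poly_Mapping.lookup v i - u i) div d t) + ?q (Suc t)"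
      by (simp add: floor[symmetric] sum.distrib sum_u sum_distrib_left)
    finally have "c t \<le> (\<Sum>i\<in>UNIV. (Poly_Mapping.lookup v i - u i) div d t)"
      using d_sequence_pos[OF ds ts] by (simp add: mult.commute)
    from ex_sum_eq_below[OF finite this] obtain k' where
      k': "sum k' UNIV = c t" "\<And>i. k' i \<le> (Poly_Mapping.lookup v i - u i) div d t"
      by blast
    have "(\<Sum>l=t..s. (k(t := k')) l i * d l) \<le> Poly_Mapping.lookup v i" for i
    proof -
      have "(\<Sum>l=t..s. (k(t := k')) l i * d l) = k' i * d t + u i"
        using ts by (simp add: sum.atLeast_Suc_atMost u_def)
      also have "\<dots> \<le> d t * ((Poly_Mapping.lookup v i - u i) div d t) + u i"
        using k'(2)[of i] by (simp add: mult.commute)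
      also have "\<dots> \<le> Poly_Mapping.lookup v i"
        unfolding floor by simp
      finally show ?thesis .
    qed
    moreover have "\<forall>l\<in>{t..s}. (\<Sum>i\<in>UNIV. (k(t := k')) l i) = c l"
      using k(1) k'(1) by auto
    ultimately show ?case
      unfolding token_exps_def by blast
  qed
qed


section \<open>The product is the smallest d-fixed ideal containing the power of the last variable\<close>

lemma lookup_Abs_finite [simp]:
  "Poly_Mapping.lookup (Abs_poly_mapping f) = (f :: 'n::finite \<Rightarrow> nat)"
  by simp

text \<open>
  If the digits of \<open>t\<close> are at most those of the exponent of \<open>x\<^sub>i\<close>, then multiplication by
  \<open>x\<^sub>j\<^sup>t / x\<^sub>i\<^sup>t\<close> decreases the room in multiples of \<open>d l\<close> at \<open>i\<close> by exactly the rounding of \<open>t\<close>,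
  and increases it at \<open>j\<close> by at least that much.
\<close>

lemma token_exps_d_fixed:
  fixes v :: "'n::finite \<Rightarrow>\<^sub>0 nat"
  assumes ds: "d_sequence s d" and v: "v \<in> token_exps {0..s} d c"
    and ij: "i \<noteq> j" and t: "d_le s d t (Poly_Mapping.lookup v i)"
  shows "v + Poly_Mapping.single j t - Poly_Mapping.single i t \<in> token_exps {0..s} d c"
    (is "?w \<in> _")
proof -
  have "(\<Sum>x\<in>UNIV. d l * (Poly_Mapping.lookup v x div d l)) \<le>
      (\<Sum>x\<in>UNIV. d l * (Poly_Mapping.lookup ?w x div d l))" if l: "l \<le> s" for l
  proof -
    let ?f = "\<lambda>x. d l * (x div d l)"
    have "?f (Poly_Mapping.lookup v x) + (if x = j then ?f t else 0) \<le>
        ?f (Poly_Mapping.lookup ?w x) + (if x = i then ?f t else 0)" for x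
      using d_le_floor_diff[OF ds t l] floor_add_le[of "d l" "Poly_Mapping.lookup v j" t] ij
      by (auto simp: lookup_add lookup_minus lookup_single when_def)
    then have "(\<Sum>x\<in>UNIV. ?f (Poly_Mapping.lookup v x) + (if x = j then ?f t else 0)) \<le>
        (\<Sum>x\<in>UNIV. ?f (Poly_Mapping.lookup ?w x) + (if x = i then ?f t else 0))"
      by (rule sum_mono)
    then show ?thesis
      by (simp add: sum.distrib)
  qed
  with v show ?thesis
    unfolding token_exps_iff[OF ds le0] by (fastforce intro: order.trans)
qed

lemma d_fixed_product_ideal:
  assumes "d_sequence s d"
  shows "d_fixed s d (product_ideal {..s} d c :: ('n::{finite,linorder}, 'k::field) mpoly set)"
proof -
  have "monomial_ideal (supp_ideal (token_exps {0..s} d c) :: ('n, 'k) mpoly set)"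
    unfolding monomial_ideal_def by (metis Idl_monom_up_closed up_closed_token_exps)
  then show ?thesis
    by (auto simp: d_fixed_def product_ideal_eq atMost_atLeast0 intro!: token_exps_d_fixed[OF assms])
qed

text \<open>
  Every product of tokens is reached from the power of the last variable \<open>x\<^sub>M\<close> by moving, for one
  variable \<open>x\<^sub>i\<close> after the other, all tokens destined for \<open>x\<^sub>i\<close> from \<open>x\<^sub>M\<close> to \<open>x\<^sub>i\<close>. The numbers of
  tokens still at \<open>x\<^sub>M\<close> are the digits of its current exponent.
\<close>

lemma product_ideal_subset_d_fixed:
  fixes L :: "('n::{finite,linorder}, 'k::field) mpoly set"
  assumes dec: "d_decomposition s d a c"
    and L: "d_fixed s d L" "monom (Poly_Mapping.single (Max UNIV) a) \<in> L"
  shows "product_ideal {..s} d c \<subseteq> L"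
proof -
  define M where "M = (Max UNIV :: 'n)"
  have ideal: "ideal L poly_ring"
    using L(1) PR.genideal_ideal by (auto simp: d_fixed_def monomial_ideal_def)
  interpret ideal L poly_ring by (rule ideal)
  have "monom v \<in> L" if v: "v \<in> token_exps {..s} d c" for v
  proof -
    obtain k where k: "\<And>t. t \<le> s \<Longrightarrow> (\<Sum>i\<in>UNIV. k t i) = c t"
        "\<And>i. (\<Sum>t\<le>s. k t i * d t) \<le> Poly_Mapping.lookup v i"
      using v unfolding token_exps_def by blast
    have le: "(\<Sum>i\<in>A. k t i) \<le> c t" if "t \<le> s" for A t
      unfolding k(1)[OF that, symmetric] by (rule sum_mono2) auto
    \<comment> \<open>the exponent reached once the tokens of the variables in \<open>A\<close> have been moved\<close>
    define w where "w A = Abs_poly_mapping (\<lambda>i. if i \<in> A then \<Sum>t\<le>s. k t i * d t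
      else if i = M then \<Sum>t\<le>s. (c t - (\<Sum>i\<in>A. k t i)) * d t else 0)" for A
    have "monom (w A) \<in> L" if "M \<notin> A" for A
      using finite[of A] that
    proof (induction A rule: finite_induct)
      case empty
      have "w {} = Poly_Mapping.single M a"
        using dec by (intro poly_mapping_eqI)
          (auto simp: w_def d_decomposition_def lookup_single when_def)
      with L(2) show ?case
        by (simp add: M_def)
    next
      case (insert i A)
      define r where "r = (\<Sum>t\<le>s. k t i * d t)"
      have le': "k t i \<le> c t - (\<Sum>i\<in>A. k t i)" if "t \<le> s" for t
        using le[OF that, of "insert i A"] insert.hyps by simp
      have bound: "c t < d (Suc t) div d t" if "t < s" for t
        using dec that by (simp add: d_decomposition_def)
      have "d_decomposition s d r (\<lambda>t. k t i)"
        unfolding d_decomposition_def r_def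
        using le_less_trans[OF le[of _ "{i}"] bound] by simp
      moreover have "d_decomposition s d (Poly_Mapping.lookup (w A) M) (\<lambda>t. c t - (\<Sum>i\<in>A. k t i))"
        unfolding d_decomposition_def w_def
        using insert.prems bound by (auto intro: le_less_trans[OF diff_le_self])
      ultimately have d_le: "d_le s d r (Poly_Mapping.lookup (w A) M)"
        unfolding d_le_def using le' by blast
      have "i < M"
        using insert.prems by (metis M_def Max_ge UNIV_I finite insertI1 order_le_less)
      with L(1) insert d_le have "monom (w A + Poly_Mapping.single i r - Poly_Mapping.single M r) \<in> L"
        unfolding d_fixed_def by blast
      also have "w A + Poly_Mapping.single i r - Poly_Mapping.single M r = w (insert i A)"
      proof (rule poly_mapping_eqI)
        fix j
        have "(\<Sum>t\<le>s. (c t - (\<Sum>i\<in>A. k t i)) * d t) - r =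
            (\<Sum>t\<le>s. (c t - (\<Sum>i\<in>A. k t i)) * d t - k t i * d t)"
          unfolding r_def using le' by (intro sum_subtractf_nat[symmetric]) simp
        also have "\<dots> = (\<Sum>t\<le>s. (c t - (\<Sum>i\<in>insert i A. k t i)) * d t)"
          using insert.hyps
          by (intro sum.cong) (auto simp flip: diff_mult_distrib simp: add.commute)
        finally show "Poly_Mapping.lookup (w A + Poly_Mapping.single i r - Poly_Mapping.single M r) j =
            Poly_Mapping.lookup (w (insert i A)) j"
          using insert.hyps insert.prems \<open>i < M\<close>
          by (auto simp: w_def lookup_add lookup_minus lookup_single when_def r_def[symmetric]
              simp del: sum.insert)
      qed
      finally show ?case .
    qed
    then have "monom (w (- {M})) \<in> L"
      by simp
    moreover have "Poly_Mapping.lookup (w (- {M})) i \<le> Poly_Mapping.lookup v i" for i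
    proof -
      have "(\<Sum>t\<le>s. (c t - (\<Sum>i\<in>- {M}. k t i)) * d t) = (\<Sum>t\<le>s. k t M * d t)"
        by (intro sum.cong) (auto simp flip: k(1) simp: sum.remove[of UNIV M] Compl_eq_Diff_UNIV)
      then show ?thesis
        using k(2)[of i] by (cases "i = M") (simp_all add: w_def)
    qed
    then have "v = w (- {M}) + (v - w (- {M}))"
      by (intro poly_mapping_eqI) (simp add: lookup_add lookup_minus)
    ultimately show ?thesis
      by (metis I_r_closed UNIV_I monom_add poly_ring_simps(1,2))
  qed
  then show ?thesis
    by (auto simp: product_ideal_eq supp_ideal_subset_iff[OF ideal])
qed

lemma single_Max_in_product_ideal:
  assumes "d_decomposition s d a c"
  shows "monom (Poly_Mapping.single (Max UNIV) a) \<in>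
    (product_ideal {..s} d c :: ('n::{finite,linorder}, 'k::field) mpoly set)"
proof -
  have "Poly_Mapping.single (Max UNIV :: 'n) a \<in> token_exps {..s} d c"
    using assms by (intro token_expsI[where k = "\<lambda>t i. if i = Max UNIV then c t else 0"])
      (auto simp: d_decomposition_def lookup_single when_def)
  then show ?thesis
    by (simp add: product_ideal_eq)
qed

lemma d_fixed_closure_eq_product_ideal:
  assumes "d_sequence s d" "d_decomposition s d a c"
  shows "d_fixed_closure s d (Poly_Mapping.single (Max UNIV) a) =
    (product_ideal {..s} d c :: ('n::{finite,linorder}, 'k::field) mpoly set)"
  unfolding d_fixed_closure_def
  using d_fixed_product_ideal[OF assms(1)] single_Max_in_product_ideal[OF assms(2)]
    product_ideal_subset_d_fixed[OF assms(2)]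
  by (intro Least_equality) blast+


section \<open>Exponents of the ideal J\<close>

text \<open>
  Exponents of the \<open>t\<close>-th summand of \<open>J\<close>: one token of size \<open>d t\<close> is replaced by
  \<open>(x\<^sub>1 \<dots> x\<^sub>n)\<close> to the power \<open>d t - 1\<close>.
\<close>

definition socle_exps ::
    "nat \<Rightarrow> (nat \<Rightarrow> nat) \<Rightarrow> (nat \<Rightarrow> nat) \<Rightarrow> nat \<Rightarrow> ('n::finite \<Rightarrow>\<^sub>0 nat) set" where
  "socle_exps s d c t =
     {v. \<exists>z\<in>token_exps {t..s} d (c(t := c t - 1)).
        \<forall>i. d t - 1 + Poly_Mapping.lookup z i \<le> Poly_Mapping.lookup v i}"

lemma up_closed_socle_exps: "up_closed (socle_exps s d c t)"
  by (fastforce simp: up_closed_def socle_exps_def lookup_add intro: trans_le_add1)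

lemma all_vars_power:
  "all_vars ^ r = (monom (Abs_poly_mapping (\<lambda>_. r)) :: ('n::finite, 'k::field) mpoly)"
proof -
  have prod: "(\<Prod>i\<in>A. monom (Poly_Mapping.single i 1)) =
      (monom (\<Sum>i\<in>A. Poly_Mapping.single i 1) :: ('n, 'k) mpoly)" for A
    by (induction A rule: infinite_finite_induct) (simp_all add: monom_add monom_zero)
  have "(\<Sum>i\<in>UNIV. Poly_Mapping.single i 1) = Abs_poly_mapping (\<lambda>_::'n. 1 :: nat)"
    by (intro poly_mapping_eqI) (simp add: lookup_sum lookup_single when_def)
  then have all_vars: "all_vars = (monom (Abs_poly_mapping (\<lambda>_. 1)) :: ('n, 'k) mpoly)"
    unfolding all_vars_def prod by simp
  show ?thesis
  proof (induction r)
    case 0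
    have "Abs_poly_mapping (\<lambda>_::'n. 0 :: nat) = 0"
      by simp
    then show ?case by (simp only: power_0 monom_zero)
  next
    case (Suc r)
    have "Abs_poly_mapping (\<lambda>_::'n. Suc r) =
        Abs_poly_mapping (\<lambda>_. 1 :: nat) + Abs_poly_mapping (\<lambda>_. r)"
      by (intro poly_mapping_eqI) (simp add: lookup_add)
    then show ?case
      unfolding power_Suc Suc.IH by (simp only: monom_add all_vars)
  qed
qed

lemma socle_ideal_summand:
  assumes "t \<le> s"
  shows "Idl\<^bsub>poly_ring\<^esub> {all_vars ^ (d t - 1)}
      \<otimes>\<^bsub>ideals_set poly_ring\<^esub> (power_ideal (d t) [^]\<^bsub>ideals_set poly_ring\<^esub> (c t - 1))
      \<otimes>\<^bsub>ideals_set poly_ring\<^esub> product_ideal {t<..s} d c =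
    (supp_ideal (socle_exps s d c t) :: ('n::finite, 'k::field) mpoly set)"
proof -
  define p :: "'n \<Rightarrow>\<^sub>0 nat" where "p = Abs_poly_mapping (\<lambda>_. d t - 1)"
  define P where "P = {p + w | w. True}"
  define c' where "c' = c(t := c t - 1)"
  have P: "Idl\<^bsub>poly_ring\<^esub> {all_vars ^ (d t - 1)} = (supp_ideal P :: ('n, 'k) mpoly set)"
    using Idl_monom[of "{p}"] by (simp add: all_vars_power P_def p_def)
  have up_P: "up_closed P"
    by (auto simp: up_closed_def P_def add.assoc)
  have "token_exps {t<..s} d c = (token_exps {t<..s} d c' :: ('n \<Rightarrow>\<^sub>0 nat) set)"
    by (simp add: token_exps_def c'_def)
  moreover have ivl: "insert t {t<..s} = {t..s}"
    using assms by auto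
  ultimately have tokens: "{v + w | v w. v \<in> power_exps (d t) (c t - 1) \<and> w \<in> token_exps {t<..s} d c} =
      (token_exps {t..s} d c' :: ('n \<Rightarrow>\<^sub>0 nat) set)"
    using token_exps_insert[of "{t<..s}" t d c'] assms
    by (simp add: c'_def ivl)
  have eq: "{v + w | v w. v \<in> P \<and> w \<in> token_exps {t..s} d c'} = socle_exps s d c t"
  proof (intro subset_antisym subsetI)
    fix u :: "'n \<Rightarrow>\<^sub>0 nat"
    assume "u \<in> socle_exps s d c t"
    then obtain z where z: "z \<in> token_exps {t..s} d c'"
        "\<And>i. d t - 1 + Poly_Mapping.lookup z i \<le> Poly_Mapping.lookup u i"
      unfolding socle_exps_def c'_def by blast
    have "u = (p + (u - p - z)) + z"
    proof (rule poly_mapping_eqI)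
      fix i
      show "Poly_Mapping.lookup u i = Poly_Mapping.lookup (p + (u - p - z) + z) i"
        using z(2)[of i] by (simp add: p_def lookup_add lookup_minus)
    qed
    with z(1) show "u \<in> {v + w | v w. v \<in> P \<and> w \<in> token_exps {t..s} d c'}"
      unfolding P_def by blast
  next
    fix u :: "'n \<Rightarrow>\<^sub>0 nat"
    assume "u \<in> {v + w | v w. v \<in> P \<and> w \<in> token_exps {t..s} d c'}"
    then obtain w z where "u = p + w + z" "z \<in> token_exps {t..s} d c'"
      unfolding P_def by blast
    then show "u \<in> socle_exps s d c t"
      unfolding socle_exps_def c'_def by (intro CollectI bexI[of _ z]) (auto simp: lookup_add p_def)
  qed
  note up = up_P up_closed_power_exps up_closed_token_exps
  note ideals = up[THEN ideal_supp_ideal]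
  show ?thesis
    unfolding P power_ideal_pow product_ideal_eq[OF finite_greaterThanAtMost] ideals_set_simps
      PR.ideal_prod_assoc[OF ideals]
    by (simp add: ideal_prod_supp_ideal up tokens eq del: One_nat_def)
qed

lemma socle_ideal_eq:
  "socle_ideal s d c =
    (supp_ideal (\<Union>t\<in>{t. t \<le> s \<and> c t > 0}. socle_exps s d c t) :: ('n::finite, 'k::field) mpoly set)"
proof -
  have "socle_ideal s d c = finsum (ideals_set poly_ring)
      (\<lambda>t. supp_ideal (socle_exps s d c t) :: ('n, 'k) mpoly set) {t. t \<le> s \<and> c t > 0}"
    unfolding socle_ideal_def
  proof (rule PS.finsum_cong'[OF refl])
    fix t
    assume "t \<in> {t. t \<le> s \<and> c t > 0}"
    then show "Idl\<^bsub>poly_ring\<^esub> {all_vars ^ (d t - 1)}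
        \<otimes>\<^bsub>ideals_set poly_ring\<^esub> (power_ideal (d t) [^]\<^bsub>ideals_set poly_ring\<^esub> (c t - 1))
        \<otimes>\<^bsub>ideals_set poly_ring\<^esub> product_ideal {t<..s} d c =
      (supp_ideal (socle_exps s d c t) :: ('n, 'k) mpoly set)"
      by (intro socle_ideal_summand) simp
  qed (simp add: ideals_set_simps ideal_supp_ideal up_closed_socle_exps)
  then show ?thesis
    by (simp add: finsum_supp_ideal up_closed_socle_exps)
qed


section \<open>Exponents of the socle\<close>

lemma floor_Suc:
  assumes "0 < (d::nat)"
  shows "d * (Suc x div d) = d * (x div d) + (if d dvd Suc x then d else 0)"
  using assms by (auto simp: div_Suc dvd_eq_mod_eq_0)

text \<open>
  A monomial outside the product that is multiplied into it by every variable fails the criterion at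
  some level; let \<open>t\<close> be the largest one. Raising any single exponent by one has to repair level
  \<open>t\<close>, so every exponent is \<open>d t - 1\<close> modulo \<open>d t\<close> and exactly one token of size \<open>d t\<close> is missing.
\<close>

lemma colon_subset_socle_exps:
  fixes v :: "'n::finite \<Rightarrow>\<^sub>0 nat"
  assumes ds: "d_sequence s d"
    and v: "v \<notin> token_exps {0..s} d c"
    and colon: "\<And>i. v + Poly_Mapping.single i 1 \<in> token_exps {0..s} d c"
  shows "\<exists>t\<le>s. c t > 0 \<and> v \<in> socle_exps s d c t"
proof -
  \<comment> \<open>\<open>q j\<close> is the total size of the tokens of size at least \<open>d j\<close>, and \<open>cap j u\<close> the room for
    them in \<open>u\<close>\<close>
  define q where "q j = (\<Sum>l=j..s. c l * d l)" for j
  define cap where "cap j u = (\<Sum>i\<in>UNIV. d j * (Poly_Mapping.lookup u i div d j))" for j and u :: "'n \<Rightarrow>\<^sub>0 nat"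
  have iff: "u \<in> token_exps {0..s} d c \<longleftrightarrow> (\<forall>j\<in>{0..s}. q j \<le> cap j u)" for u :: "'n \<Rightarrow>\<^sub>0 nat"
    unfolding q_def cap_def by (rule token_exps_iff[OF ds le0])
  define t where "t = Max {j. j \<le> s \<and> cap j v < q j}"
  have ne: "{j. j \<le> s \<and> cap j v < q j} \<noteq> {}"
    using v unfolding iff by auto
  then have "t \<in> {j. j \<le> s \<and> cap j v < q j}"
    unfolding t_def by (intro Max_in) auto
  then have t: "t \<le> s" "cap t v < q t"
    by auto
  have above: "q j \<le> cap j v" if "t < j" "j \<le> s" for j
  proof (rule ccontr)
    assume "\<not> q j \<le> cap j v"
    with that have "j \<le> t"
      unfolding t_def by (intro Max_ge) auto
    with that show False by simp
  qed
  have dt: "0 < d t"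
    using d_sequence_pos[OF ds t(1)] .
  have q_t: "q t = c t * d t + q (Suc t)"
    unfolding q_def using t(1) by (simp add: sum.atLeast_Suc_atMost)
  \<comment> \<open>with \<open>c t = 0\<close> this would be the criterion at level \<open>t\<close>, which fails\<close>
  have "q (Suc t) \<le> cap t v"
  proof (cases "t = s")
    case True
    then show ?thesis by (simp add: q_def)
  next
    case False
    then have "q (Suc t) \<le> cap (Suc t) v"
      using above[of "Suc t"] t(1) by simp
    also have "\<dots> \<le> cap t v"
      unfolding cap_def
    proof (rule sum_mono)
      fix i
      show "d (Suc t) * (Poly_Mapping.lookup v i div d (Suc t)) \<le>
          d t * (Poly_Mapping.lookup v i div d t)"
        using d_sequence_dvd[OF ds, of t "Suc t"] False t(1) by (intro floor_antimono) simp
    qed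
    finally show ?thesis .
  qed
  with t(2) q_t have ct: "c t > 0"
    by (cases "c t") auto
  have cap_Suc: "cap t (v + Poly_Mapping.single i 1) =
      cap t v + (if d t dvd Suc (Poly_Mapping.lookup v i) then d t else 0)" for i
  proof -
    have "cap t (v + Poly_Mapping.single i 1) =
        (\<Sum>j\<in>UNIV. d t * (Poly_Mapping.lookup v j div d t) +
          (if j = i then if d t dvd Suc (Poly_Mapping.lookup v i) then d t else 0 else 0))"
      unfolding cap_def
      by (intro sum.cong) (auto simp: lookup_add lookup_single when_def floor_Suc[OF dt])
    then show ?thesis
      by (simp add: sum.distrib cap_def)
  qed
  have ge: "q t \<le> cap t (v + Poly_Mapping.single i 1)" for i
    using colon[of i] t(1) unfolding iff by auto
  have dvd: "d t dvd Suc (Poly_Mapping.lookup v i)" for i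
    using ge[of i] t(2) unfolding cap_Suc by (auto split: if_splits)
  define z where "z = Abs_poly_mapping (\<lambda>i. Poly_Mapping.lookup v i - (d t - 1))"
  have z: "Poly_Mapping.lookup v i = d t - 1 + Poly_Mapping.lookup z i" "d t dvd Poly_Mapping.lookup z i" for i
  proof -
    obtain r where r: "Suc (Poly_Mapping.lookup v i) = d t * r"
      using dvd[of i] by (elim dvdE)
    then obtain r' where "r = Suc r'"
      by (cases r) auto
    with r dt show "Poly_Mapping.lookup v i = d t - 1 + Poly_Mapping.lookup z i" "d t dvd Poly_Mapping.lookup z i"
      by (auto simp: z_def)
  qed
  have cap_z: "cap j z = cap j v" if j: "t \<le> j" "j \<le> s" for j
  proof -
    obtain r where r: "d j = d t * r"
      using d_sequence_dvd[OF ds j] by (elim dvdE)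
    have "Poly_Mapping.lookup v i div d j = Poly_Mapping.lookup z i div d j" for i
    proof -
      have "Poly_Mapping.lookup v i div d t = Poly_Mapping.lookup z i div d t"
        using z[of i] dt pred_add_mult_div[OF dt] by (elim dvdE) (simp del: One_nat_def)
      then show ?thesis
        unfolding r div_mult2_eq by simp
    qed
    then show ?thesis
      by (simp add: cap_def)
  qed
  have "z \<in> token_exps {t..s} d (c(t := c t - 1))"
    unfolding token_exps_iff[OF ds le_SucI[OF t(1)]]
  proof
    fix j
    assume j: "j \<in> {t..s}"
    have "(\<Sum>l=j..s. (c(t := c t - 1)) l * d l) \<le> cap j z"
    proof (cases "j = t")
      case True
      have "(\<Sum>l=t..s. (c(t := c t - 1)) l * d l) + d t = q t"
        unfolding q_def using t(1) ct by (rule sum_decrement)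
      also have "\<dots> \<le> cap t z + d t"
        using ge[of undefined] dvd cap_z[of t] t(1) unfolding cap_Suc by simp
      finally show ?thesis
        using True by simp
    next
      case False
      then have "(\<Sum>l=j..s. (c(t := c t - 1)) l * d l) = q j"
        unfolding q_def using j by (intro sum.cong) auto
      then show ?thesis
        using above[of j] cap_z[of j] j False by simp
    qed
    then show "(\<Sum>l=j..s. (c(t := c t - 1)) l * d l) \<le>
        (\<Sum>i\<in>UNIV. d j * (Poly_Mapping.lookup z i div d j))"
      by (simp add: cap_def)
  qed
  then have "v \<in> socle_exps s d c t"
    unfolding socle_exps_def using z(1) by auto
  with t(1) ct show ?thesis by blast
qed

text \<open>
  Conversely, multiplication by \<open>x\<^sub>i\<close> completes the missing token of size \<open>d t\<close> at \<open>i\<close>. The smaller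
  tokens have total size at most \<open>d t - 1\<close>, by the digit bounds, and go to a second variable,
  where \<open>d t - 1\<close> is still free; this is where at least two variables are needed.
\<close>

lemma socle_exps_colon:
  fixes v :: "'n::finite \<Rightarrow>\<^sub>0 nat"
  assumes card: "CARD('n) \<ge> 2" and ds: "d_sequence s d"
    and digits: "\<And>t. t < s \<Longrightarrow> c t < d (Suc t) div d t"
    and t: "t \<le> s" "c t > 0" and v: "v \<in> socle_exps s d c t"
  shows "v + Poly_Mapping.single i 1 \<in> token_exps {0..s} d c"
proof -
  let ?c = "c(t := c t - 1)"
  obtain z where z: "z \<in> token_exps {t..s} d ?c"
      "\<And>i. d t - 1 + Poly_Mapping.lookup z i \<le> Poly_Mapping.lookup v i"
    using v unfolding socle_exps_def by blast
  define w where "w = v + Poly_Mapping.single i 1"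
  have dt: "0 < d t"
    using d_sequence_pos[OF ds t(1)] .
  obtain i' where i': "i' \<noteq> i"
    using card
    by (metis card_1_singleton_iff UNIV_eq_I One_nat_def insertI1 numeral_le_one_iff
        semiring_norm(69) singletonD)
  have w_i: "d t + Poly_Mapping.lookup z i \<le> Poly_Mapping.lookup w i"
    using z(2)[of i] dt by (simp add: w_def lookup_add)
  have w_j: "d t - 1 + Poly_Mapping.lookup z j \<le> Poly_Mapping.lookup w j" for j
    using z(2)[of j] by (simp add: w_def lookup_add)
  have z_cap: "(\<Sum>l=j..s. ?c l * d l) \<le> (\<Sum>x\<in>UNIV. d j * (Poly_Mapping.lookup z x div d j))"
    if "j \<in> {t..s}" for j
    using z(1) that unfolding token_exps_iff[OF ds le_SucI[OF t(1)]] by blast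
  have q_t: "(\<Sum>l=t..s. ?c l * d l) + d t = (\<Sum>l=t..s. c l * d l)"
    using t by (rule sum_decrement)
  have "(\<Sum>l=j..s. c l * d l) \<le> (\<Sum>x\<in>UNIV. d j * (Poly_Mapping.lookup w x div d j))"
    if j: "j \<le> s" for j
  proof -
    let ?f = "\<lambda>x. d j * (x div d j)"
    have mono: "?f x \<le> ?f y" if "x \<le> y" for x y
      using that by (simp add: div_le_mono)
    consider "t < j" | "j = t" | "j < t"
      by linarith
    then show ?thesis
    proof cases
      case 1
      have "(\<Sum>l=j..s. c l * d l) = (\<Sum>l=j..s. ?c l * d l)"
        using 1 by (intro sum.cong) auto
      also have "\<dots> \<le> (\<Sum>x\<in>UNIV. ?f (Poly_Mapping.lookup z x))"
        using z_cap[of j] 1 j by simp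
      also have "\<dots> \<le> (\<Sum>x\<in>UNIV. ?f (Poly_Mapping.lookup w x))"
        using w_j by (intro sum_mono mono) (meson add_leE)
      finally show ?thesis .
    next
      case 2
      have "(\<Sum>l=j..s. c l * d l) \<le> (\<Sum>x\<in>UNIV. ?f (Poly_Mapping.lookup z x)) + d t"
        using z_cap[of t] t(1) q_t 2 by simp
      also have "\<dots> = (\<Sum>x\<in>UNIV. ?f (Poly_Mapping.lookup z x) + (if x = i then d t else 0))"
        by (simp add: sum.distrib)
      also have "\<dots> \<le> (\<Sum>x\<in>UNIV. ?f (Poly_Mapping.lookup w x))"
      proof (rule sum_mono)
        fix x
        show "?f (Poly_Mapping.lookup z x) + (if x = i then d t else 0) \<le> ?f (Poly_Mapping.lookup w x)"
        proof (cases "x = i")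
          case True
          have "?f (Poly_Mapping.lookup z i) + d t = ?f (d t + Poly_Mapping.lookup z i)"
            using 2 dt by (simp add: div_add_self1)
          then show ?thesis
            using mono[OF w_i] True by simp
        next
          case False
          then show ?thesis
            using mono[of "Poly_Mapping.lookup z x" "Poly_Mapping.lookup w x"] w_j[of x] by simp
        qed
      qed
      finally show ?thesis .
    next
      case 3
      have dvd: "d j dvd d t"
        using d_sequence_dvd[OF ds] 3 t(1) by simp
      have dj: "0 < d j"
        using d_sequence_pos[OF ds j] .
      have below: "?f (d t - 1) = d t - d j"
      proof -
        obtain r where r: "d t = d j * r"
          using dvd by (elim dvdE)
        with dt obtain r' where "r = Suc r'"
          by (cases r) auto
        then have "d t = d j * r' + d j"
          using r by simp
        then have "d t - 1 = d j - 1 + d j * r'"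
          using dj by linarith
        then have "?f (d t - 1) = d j * r'"
          by (simp only: pred_add_mult_div[OF dj])
        with \<open>d t = d j * r' + d j\<close> show ?thesis
          by simp
      qed
      have z_le: "(\<Sum>l=t..s. ?c l * d l) \<le> (\<Sum>x\<in>UNIV. ?f (Poly_Mapping.lookup z x))"
      proof (rule order.trans[OF z_cap])
        show "(\<Sum>x\<in>UNIV. d t * (Poly_Mapping.lookup z x div d t)) \<le> (\<Sum>x\<in>UNIV. ?f (Poly_Mapping.lookup z x))"
          by (intro sum_mono floor_antimono dvd)
      qed (use t(1) in simp)
      have "(\<Sum>l=j..s. c l * d l) = (\<Sum>l=j..<t. c l * d l) + (\<Sum>l=t..s. c l * d l)"
        using sum.atLeastLessThan_concat[of j t "Suc s" "\<lambda>l. c l * d l"] 3 t(1)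
        by (simp add: atLeastLessThanSuc_atLeastAtMost)
      also have "\<dots> \<le> (d t - d j) + ((\<Sum>x\<in>UNIV. ?f (Poly_Mapping.lookup z x)) + d t)"
        using sum_digits_below[OF ds digits, where l = j and t = t] 3 t(1) z_le q_t by simp
      also have "\<dots> = (\<Sum>x\<in>UNIV. ?f (Poly_Mapping.lookup z x) + (if x = i then d t else 0) +
          (if x = i' then d t - d j else 0))"
        by (simp add: sum.distrib)
      also have "\<dots> \<le> (\<Sum>x\<in>UNIV. ?f (Poly_Mapping.lookup w x))"
      proof (rule sum_mono)
        fix x
        have "?f (Poly_Mapping.lookup z i) + d t \<le> ?f (Poly_Mapping.lookup w i)"
        proof -
          have "?f (Poly_Mapping.lookup z i) + d t = ?f (Poly_Mapping.lookup z i) + ?f (d t)"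
            using dvd by simp
          also have "\<dots> \<le> ?f (Poly_Mapping.lookup w i)"
            using order.trans[OF floor_add_le mono[OF w_i]] by (simp add: add.commute)
          finally show ?thesis .
        qed
        moreover have "?f (Poly_Mapping.lookup z i') + (d t - d j) \<le> ?f (Poly_Mapping.lookup w i')"
          using order.trans[OF floor_add_le mono[OF w_j[of i']]] unfolding below by (simp add: add.commute)
        moreover have "?f (Poly_Mapping.lookup z x) \<le> ?f (Poly_Mapping.lookup w x)"
          using w_j[of x] by (intro mono) (rule add_leD2)
        ultimately show "?f (Poly_Mapping.lookup z x) + (if x = i then d t else 0) +
            (if x = i' then d t - d j else 0) \<le> ?f (Poly_Mapping.lookup w x)"
          using i' by auto
      qed
      finally show ?thesis .
    qed
  qed
  then show ?thesis
    unfolding token_exps_iff[OF ds le0] w_def by simp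
qed

text \<open>
  Each summand of \<open>J\<close> is generated in a single degree, and a proper multiple of a generator lies in
  the product by the preceding lemma; so the remaining monomials have the degree of the generators.
\<close>

lemma sum_lookup_socle_exps:
  fixes v :: "'n::finite \<Rightarrow>\<^sub>0 nat"
  assumes card: "CARD('n) \<ge> 2" and ds: "d_sequence s d"
    and digits: "\<And>t. t < s \<Longrightarrow> c t < d (Suc t) div d t"
    and t: "t \<le> s" "c t > 0" and v: "v \<in> socle_exps s d c t" "v \<notin> token_exps {0..s} d c"
  shows "(\<Sum>i\<in>UNIV. Poly_Mapping.lookup v i) =
    (\<Sum>j=t..s. c j * d j) + (CARD('n) - 1) * (d t - 1) - 1"
proof -
  let ?c = "c(t := c t - 1)"
  obtain z where z: "z \<in> token_exps {t..s} d ?c"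
      "\<And>i. d t - 1 + Poly_Mapping.lookup z i \<le> Poly_Mapping.lookup v i"
    using v unfolding socle_exps_def by blast
  then obtain k where k: "\<And>l. l \<in> {t..s} \<Longrightarrow> (\<Sum>i\<in>UNIV. k l i) = ?c l"
      "\<And>i. (\<Sum>l=t..s. k l i * d l) \<le> Poly_Mapping.lookup z i"
    unfolding token_exps_def by blast
  \<comment> \<open>\<open>u\<close> is the exponent of a generator dividing the monomial of \<open>v\<close>\<close>
  define y where "y = Abs_poly_mapping (\<lambda>i. \<Sum>l=t..s. k l i * d l)"
  define u where "u = Abs_poly_mapping (\<lambda>i. d t - 1 + Poly_Mapping.lookup y i)"
  have "y \<in> token_exps {t..s} d ?c"
    using k(1) by (rule token_expsI) (simp_all add: y_def)
  then have u: "u \<in> socle_exps s d c t"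
    unfolding socle_exps_def by (auto simp: u_def)
  have le: "Poly_Mapping.lookup u i \<le> Poly_Mapping.lookup v i" for i
    using z(2)[of i] k(2)[of i] by (simp add: u_def y_def)
  have "v = u"
  proof (rule ccontr)
    assume "v \<noteq> u"
    then obtain i where "Poly_Mapping.lookup v i \<noteq> Poly_Mapping.lookup u i"
      by (meson poly_mapping_eqI)
    with le[of i] have "Poly_Mapping.lookup u i < Poly_Mapping.lookup v i"
      by simp
    then have "v = (u + Poly_Mapping.single i 1) + (v - (u + Poly_Mapping.single i 1))"
      using le by (intro poly_mapping_eqI) (auto simp: lookup_add lookup_minus lookup_single when_def)
    with socle_exps_colon[OF card ds digits t u] v(2) show False
      by (metis up_closedD up_closed_token_exps)
  qed
  have "(\<Sum>i\<in>UNIV. Poly_Mapping.lookup y i) = (\<Sum>l=t..s. \<Sum>i\<in>UNIV. k l i * d l)"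
    unfolding y_def lookup_Abs_finite by (rule sum.swap)
  also have "\<dots> = (\<Sum>l=t..s. ?c l * d l)"
    unfolding sum_distrib_right[symmetric] by (intro sum.cong refl arg_cong2[where f = "(*)"] k(1))
  finally have "(\<Sum>i\<in>UNIV. Poly_Mapping.lookup y i) = (\<Sum>l=t..s. ?c l * d l)" .
  moreover have "(\<Sum>l=t..s. ?c l * d l) + d t = (\<Sum>l=t..s. c l * d l)"
    using t by (rule sum_decrement)
  moreover have "(\<Sum>i\<in>UNIV. Poly_Mapping.lookup v i) =
      CARD('n) * (d t - 1) + (\<Sum>i\<in>UNIV. Poly_Mapping.lookup y i)"
    unfolding \<open>v = u\<close> by (simp add: u_def sum.distrib)
  moreover obtain n where "CARD('n) = Suc n"
    using card by (cases "CARD('n)") auto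
  moreover obtain e where "d t = Suc e"
    using d_sequence_pos[OF ds t(1)] by (cases "d t") auto
  ultimately show ?thesis
    by simp
qed

text \<open>
  Placing all remaining tokens at one variable gives a generator of the \<open>t\<close>-th summand of \<open>J\<close> that
  fails the criterion at level \<open>t\<close>.
\<close>

lemma ex_socle_exps_notin_token_exps:
  assumes ds: "d_sequence s d" and t: "t \<le> s" "c t > 0"
  shows "\<exists>v \<in> socle_exps s d c t. (v :: 'n::finite \<Rightarrow>\<^sub>0 nat) \<notin> token_exps {0..s} d c"
proof -
  let ?c = "c(t := c t - 1)"
  define i :: 'n where "i = undefined"
  define q where "q = (\<Sum>l=t..s. ?c l * d l)"
  define z where "z = Poly_Mapping.single i q"
  define v where "v = Abs_poly_mapping (\<lambda>x. d t - 1 + Poly_Mapping.lookup z x)"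
  have dt: "0 < d t"
    using d_sequence_pos[OF ds t(1)] .
  have "z \<in> token_exps {t..s} d ?c"
    by (rule token_expsI[where k = "\<lambda>l x. if x = i then ?c l else 0"])
      (auto simp: z_def q_def lookup_single when_def)
  then have "v \<in> socle_exps s d c t"
    unfolding socle_exps_def v_def by auto
  moreover have "v \<notin> token_exps {0..s} d c"
  proof
    assume "v \<in> token_exps {0..s} d c"
    then have "(\<Sum>l=t..s. c l * d l) \<le> (\<Sum>x\<in>UNIV. d t * (Poly_Mapping.lookup v x div d t))"
      unfolding token_exps_iff[OF ds le0] using t(1) by auto
    also have "\<dots> = (\<Sum>x\<in>UNIV. if x = i then q else 0)"
    proof (rule sum.cong)
      fix x
      have "d t dvd q"
        unfolding q_def using ds by (intro dvd_sum dvd_mult) (auto intro: d_sequence_dvd)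
      then show "d t * (Poly_Mapping.lookup v x div d t) = (if x = i then q else 0)"
        using dt pred_add_mult_div[OF dt]
        by (elim dvdE) (simp add: v_def z_def lookup_single when_def del: One_nat_def)
    qed simp
    also have "\<dots> = q"
      by simp
    finally have "(\<Sum>l=t..s. c l * d l) \<le> q" .
    moreover have "q + d t = (\<Sum>l=t..s. c l * d l)"
      unfolding q_def using t by (rule sum_decrement)
    ultimately show False
      using dt by simp
  qed
  ultimately show ?thesis by blast
qed


section \<open>Socle and graded pieces of a quotient by a monomial ideal\<close>

lemma coset_eq_iff:
  assumes "ideal I poly_ring"
  shows "I +>\<^bsub>poly_ring\<^esub> f = I +>\<^bsub>poly_ring\<^esub> g \<longleftrightarrow> f - g \<in> (I :: ('n, 'k::field) mpoly set)"
  using PR.quotient_eq_iff_same_a_r_cos[OF assms, of f g] by (simp add: a_minus_def)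

lemma coset_eq_zero_iff:
  assumes "ideal I poly_ring"
  shows "I +>\<^bsub>poly_ring\<^esub> f = I \<longleftrightarrow> f \<in> (I :: ('n, 'k::field) mpoly set)"
  using ideal.rcos_const_imp_mem[OF assms, of f] PR.a_rcos_zero[OF assms, of f] by auto

text \<open>
  Annihilation by all variables can be tested monomial by monomial, so the socle is spanned by
  monomials.
\<close>

lemma socle_supp_ideal:
  assumes "up_closed A"
  shows "socle (supp_ideal A) = (+>\<^bsub>poly_ring\<^esub>) (supp_ideal A) `
    (supp_ideal {v. \<forall>i. v + Poly_Mapping.single i 1 \<in> A} :: ('n, 'k::field) mpoly set)"
proof -
  let ?I = "supp_ideal A :: ('n, 'k) mpoly set"
  interpret I: ideal ?I poly_ring
    by (rule ideal_supp_ideal[OF assms])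
  have zero: "\<zero>\<^bsub>poly_ring Quot ?I\<^esub> = ?I"
    by (simp add: FactRing_def)
  have mult: "(?I +>\<^bsub>poly_ring\<^esub> g) \<otimes>\<^bsub>poly_ring Quot ?I\<^esub> (?I +>\<^bsub>poly_ring\<^esub> f) = ?I +>\<^bsub>poly_ring\<^esub> (g * f)" for f g
    using I.rcoset_mult_add[of g f] by (simp add: FactRing_def)
  have carrier: "carrier (poly_ring Quot ?I) = range ((+>\<^bsub>poly_ring\<^esub>) ?I)"
    by (auto simp: FactRing_def A_RCOSETS_def')
  have colon: "(\<forall>g\<in>power_ideal 1. g * f \<in> ?I) \<longleftrightarrow>
      f \<in> supp_ideal {v. \<forall>i. v + Poly_Mapping.single i 1 \<in> A}" for f :: "('n, 'k) mpoly"
  proof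
    assume *: "\<forall>g\<in>power_ideal 1. g * f \<in> ?I"
    have "v + Poly_Mapping.single i 1 \<in> A" if v: "v \<in> Poly_Mapping.keys f" for v i
    proof -
      have "monom (Poly_Mapping.single i 1) \<in> (power_ideal 1 :: ('n, 'k) mpoly set)"
        unfolding power_ideal_eq monom_in_supp_ideal by (auto intro: exI[of _ i])
      then have "monom (Poly_Mapping.single i 1) * f \<in> ?I"
        using * by blast
      moreover have "Poly_Mapping.single i 1 + v \<in> Poly_Mapping.keys (monom (Poly_Mapping.single i 1) * f)"
        using v unfolding in_keys_iff lookup_monom_mult .
      ultimately show ?thesis
        unfolding supp_ideal_def by (metis add.commute mem_Collect_eq subsetD)
    qed
    then show "f \<in> supp_ideal {v. \<forall>i. v + Poly_Mapping.single i 1 \<in> A}"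
      by (auto simp: supp_ideal_def)
  next
    assume f: "f \<in> supp_ideal {v. \<forall>i. v + Poly_Mapping.single i 1 \<in> A}"
    show "\<forall>g\<in>power_ideal 1. g * f \<in> ?I"
    proof
      fix g :: "('n, 'k) mpoly"
      assume g: "g \<in> power_ideal 1"
      have "w \<in> A" if w: "w \<in> Poly_Mapping.keys (g * f)" for w
      proof -
        obtain u v where uv: "w = u + v" "u \<in> Poly_Mapping.keys g" "v \<in> Poly_Mapping.keys f"
          using keys_mult[of g f] w by blast
        then obtain i where i: "1 \<le> Poly_Mapping.lookup u i"
          using g uv(2) unfolding power_ideal_eq supp_ideal_def by blast
        have "w = (v + Poly_Mapping.single i 1) + (u - Poly_Mapping.single i 1)"
          unfolding uv(1) using i
          by (intro poly_mapping_eqI) (auto simp: lookup_add lookup_minus lookup_single when_def)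
        moreover have "v + Poly_Mapping.single i 1 \<in> A"
          using f uv(3) by (auto simp: supp_ideal_def)
        ultimately show ?thesis
          using up_closedD[OF assms] by simp
      qed
      then show "g * f \<in> ?I"
        by (auto simp: supp_ideal_def)
    qed
  qed
  have "(\<forall>g\<in>power_ideal 1. (?I +>\<^bsub>poly_ring\<^esub> g) \<otimes>\<^bsub>poly_ring Quot ?I\<^esub> (?I +>\<^bsub>poly_ring\<^esub> f) = ?I) \<longleftrightarrow>
      f \<in> supp_ideal {v. \<forall>i. v + Poly_Mapping.single i 1 \<in> A}" for f
    unfolding mult coset_eq_zero_iff[OF I.is_ideal] by (rule colon)
  then show ?thesis
    unfolding socle_def carrier zero by fast
qed

lemma graded_component_nonzero_iff:
  assumes "up_closed A" "up_closed B"
  shows "graded_component (supp_ideal A) e (quotient_image (supp_ideal B) (supp_ideal A)) \<noteq>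
      {\<zero>\<^bsub>poly_ring Quot (supp_ideal A :: ('n::finite, 'k::field) mpoly set)\<^esub>} \<longleftrightarrow>
    (\<exists>v\<in>B - A. (\<Sum>i\<in>UNIV. Poly_Mapping.lookup v i) = e)"
proof -
  let ?I = "supp_ideal A :: ('n, 'k) mpoly set"
  let ?N = "quotient_image (supp_ideal B) ?I"
  have ideal: "ideal ?I poly_ring"
    by (rule ideal_supp_ideal[OF assms(1)])
  have zero: "\<zero>\<^bsub>poly_ring Quot ?I\<^esub> = ?I"
    by (simp add: FactRing_def)
  have N: "?N = (+>\<^bsub>poly_ring\<^esub>) ?I ` supp_ideal (B \<union> A)"
    unfolding quotient_image_def set_add_supp_ideal[OF assms(2,1)] ..
  have mem: "?I +>\<^bsub>poly_ring\<^esub> f \<in> ?N \<longleftrightarrow> f \<in> supp_ideal (B \<union> A)" for f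
  proof
    interpret BA: ideal "supp_ideal (B \<union> A) :: ('n, 'k) mpoly set" poly_ring
      by (rule ideal_supp_ideal[OF up_closed_Un[OF assms(2,1)]])
    assume "?I +>\<^bsub>poly_ring\<^esub> f \<in> ?N"
    then obtain g where g: "g \<in> supp_ideal (B \<union> A)" "f - g \<in> ?I"
      unfolding N by (auto simp: coset_eq_iff[OF ideal])
    then have "f - g \<in> supp_ideal (B \<union> A)"
      by (auto simp: supp_ideal_def)
    with g(1) show "f \<in> supp_ideal (B \<union> A)"
      using BA.a_closed[of "f - g" g] by simp
  qed (auto simp: N)
  have "?I +>\<^bsub>poly_ring\<^esub> 0 = ?I" "?I +>\<^bsub>poly_ring\<^esub> 0 \<in> ?N"
    unfolding mem coset_eq_zero_iff[OF ideal] by (auto simp: supp_ideal_def)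
  moreover have "homogeneous e (0 :: ('n, 'k) mpoly)"
    by (simp add: homogeneous_def)
  ultimately have "?I \<in> graded_component ?I e ?N"
    unfolding graded_component_def by (metis (mono_tags, lifting) IntI mem_Collect_eq)
  then have "graded_component ?I e ?N \<noteq> {?I} \<longleftrightarrow> (\<exists>X\<in>graded_component ?I e ?N. X \<noteq> ?I)"
    by blast
  also have "\<dots> \<longleftrightarrow> (\<exists>f. homogeneous e f \<and> f \<in> supp_ideal (B \<union> A) \<and> f \<notin> ?I)"
  proof
    assume "\<exists>X\<in>graded_component ?I e ?N. X \<noteq> ?I"
    then show "\<exists>f. homogeneous e f \<and> f \<in> supp_ideal (B \<union> A) \<and> f \<notin> ?I"
      unfolding graded_component_def using mem coset_eq_zero_iff[OF ideal] by auto
  next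
    assume "\<exists>f. homogeneous e f \<and> f \<in> supp_ideal (B \<union> A) \<and> f \<notin> ?I"
    then obtain f where "homogeneous e f" "f \<in> supp_ideal (B \<union> A)" "f \<notin> ?I"
      by blast
    then show "\<exists>X\<in>graded_component ?I e ?N. X \<noteq> ?I"
      unfolding graded_component_def
      by (intro bexI[of _ "?I +>\<^bsub>poly_ring\<^esub> f"]) (auto simp: mem coset_eq_zero_iff[OF ideal])
  qed
  also have "\<dots> \<longleftrightarrow> (\<exists>v\<in>B - A. (\<Sum>i\<in>UNIV. Poly_Mapping.lookup v i) = e)"
  proof
    assume "\<exists>f. homogeneous e f \<and> f \<in> supp_ideal (B \<union> A) \<and> f \<notin> ?I"
    then show "\<exists>v\<in>B - A. (\<Sum>i\<in>UNIV. Poly_Mapping.lookup v i) = e"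
      by (fastforce simp: homogeneous_def supp_ideal_def)
  next
    assume "\<exists>v\<in>B - A. (\<Sum>i\<in>UNIV. Poly_Mapping.lookup v i) = e"
    then obtain v where "v \<in> B - A" "(\<Sum>i\<in>UNIV. Poly_Mapping.lookup v i) = e"
      by blast
    then show "\<exists>f. homogeneous e f \<and> f \<in> supp_ideal (B \<union> A) \<and> f \<notin> ?I"
      by (intro exI[of _ "monom v"]) (simp add: homogeneous_def)
  qed
  finally show ?thesis
    unfolding zero .
qed


section \<open>The socle and its degrees\<close>

theorem lemma1p5p1:
  fixes s a :: nat and d \<alpha> :: "nat \<Rightarrow> nat"
    and I J :: "('n::{finite,linorder}, 'k::field) mpoly set"
  assumes "CARD('n) \<ge> 2"
    and "d_sequence s d"
    and "d_decomposition s d a \<alpha>"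
    and "I = d_fixed_closure s d (Poly_Mapping.single (Max UNIV) a)"
    and "J = socle_ideal s d \<alpha>"
  shows "I = product_ideal {..s} d \<alpha>
    \<and> socle I = quotient_image J I
    \<and> (\<forall>e>0. graded_component I e (quotient_image J I) \<noteq> {\<zero>\<^bsub>poly_ring Quot I\<^esub>} \<longleftrightarrow>
         (\<exists>t\<le>s. \<alpha> t > 0 \<and> e = (\<Sum>j=t..s. \<alpha> j * d j) + (CARD('n) - 1) * (d t - 1) - 1))
    \<and> (\<alpha> s \<noteq> 0 \<longrightarrow>
         (let E = {e. graded_component I e (quotient_image J I) \<noteq> {\<zero>\<^bsub>poly_ring Quot I\<^esub>}}
          in finite E \<and> E \<noteq> {} \<and> Max E = \<alpha> s * d s + (CARD('n) - 1) * (d s - 1) - 1))"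
proof -
  note card = assms(1) and ds = assms(2)
  have digits: "\<alpha> t < d (Suc t) div d t" if "t < s" for t
    using assms(3) that by (simp add: d_decomposition_def)
  define A :: "('n \<Rightarrow>\<^sub>0 nat) set" where "A = token_exps {0..s} d \<alpha>"
  define B :: "('n \<Rightarrow>\<^sub>0 nat) set" where "B = (\<Union>t\<in>{t. t \<le> s \<and> \<alpha> t > 0}. socle_exps s d \<alpha> t)"
  have I_prod: "I = product_ideal {..s} d \<alpha>"
    unfolding assms(4) by (rule d_fixed_closure_eq_product_ideal[OF ds assms(3)])
  then have I: "I = supp_ideal A"
    by (simp add: product_ideal_eq A_def atMost_atLeast0)
  have J: "J = supp_ideal B"
    unfolding assms(5) B_def by (rule socle_ideal_eq)
  have up: "up_closed A" "up_closed B"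
    unfolding A_def B_def
    by (auto intro!: up_closed_token_exps up_closed_UN up_closed_socle_exps)
  have "{v. \<forall>i. v + Poly_Mapping.single i 1 \<in> A} = B \<union> A"
  proof (intro subset_antisym subsetI)
    fix v
    assume "v \<in> {v. \<forall>i. v + Poly_Mapping.single i 1 \<in> A}"
    then show "v \<in> B \<union> A"
      using colon_subset_socle_exps[OF ds, of v \<alpha>] unfolding A_def B_def by blast
  next
    fix v
    assume "v \<in> B \<union> A"
    then show "v \<in> {v. \<forall>i. v + Poly_Mapping.single i 1 \<in> A}"
      using socle_exps_colon[OF card ds digits] up_closedD[OF up(1)]
      unfolding A_def B_def by blast
  qed
  then have socle: "socle I = quotient_image J I"
    unfolding I J quotient_image_def set_add_supp_ideal[OF up(2,1)] socle_supp_ideal[OF up(1)]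
    by (simp only:)
  define \<delta> where "\<delta> t = (\<Sum>j=t..s. \<alpha> j * d j) + (CARD('n) - 1) * (d t - 1) - 1" for t
  have graded: "graded_component I e (quotient_image J I) \<noteq> {\<zero>\<^bsub>poly_ring Quot I\<^esub>} \<longleftrightarrow>
      (\<exists>t\<le>s. \<alpha> t > 0 \<and> e = \<delta> t)" for e
  proof -
    have degree: "(\<Sum>i\<in>UNIV. Poly_Mapping.lookup v i) = \<delta> t"
      if "t \<le> s" "\<alpha> t > 0" "v \<in> socle_exps s d \<alpha> t" "v \<notin> A" for t v
      using sum_lookup_socle_exps[OF card ds digits] that unfolding A_def \<delta>_def by blast
    have ex: "\<exists>v\<in>socle_exps s d \<alpha> t. v \<notin> A" if "t \<le> s" "\<alpha> t > 0" for t
      unfolding A_def using ex_socle_exps_notin_token_exps[of s d t \<alpha>] ds that by blast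
    have "(\<exists>v\<in>B - A. (\<Sum>i\<in>UNIV. Poly_Mapping.lookup v i) = e) \<longleftrightarrow>
        (\<exists>t\<le>s. \<alpha> t > 0 \<and> e = \<delta> t)"
    proof
      assume "\<exists>v\<in>B - A. (\<Sum>i\<in>UNIV. Poly_Mapping.lookup v i) = e"
      then show "\<exists>t\<le>s. \<alpha> t > 0 \<and> e = \<delta> t"
        using degree unfolding B_def by blast
    next
      assume "\<exists>t\<le>s. \<alpha> t > 0 \<and> e = \<delta> t"
      then obtain t where t: "t \<le> s" "\<alpha> t > 0" "e = \<delta> t"
        by blast
      with ex obtain v where "v \<in> socle_exps s d \<alpha> t" "v \<notin> A"
        by blast
      with t degree show "\<exists>v\<in>B - A. (\<Sum>i\<in>UNIV. Poly_Mapping.lookup v i) = e"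
        unfolding B_def by (intro bexI[of _ v]) auto
    qed
    then show ?thesis
      unfolding I J graded_component_nonzero_iff[OF up] .
  qed
  have \<delta>_s: "\<delta> s = \<alpha> s * d s + (CARD('n) - 1) * (d s - 1) - 1"
    by (simp add: \<delta>_def)
  define E where "E = {e. graded_component I e (quotient_image J I) \<noteq> {\<zero>\<^bsub>poly_ring Quot I\<^esub>}}"
  have E: "E = \<delta> ` {t. t \<le> s \<and> \<alpha> t > 0}"
    unfolding E_def graded by auto
  have "finite E \<and> E \<noteq> {} \<and> Max E = \<delta> s" if "\<alpha> s \<noteq> 0"
  proof -
    \<comment> \<open>the digits in positions \<open>t\<close> to \<open>s - 1\<close> contribute at most \<open>d s - d t\<close>; since \<open>CARD('n) \<ge> 2\<close>, the other
      summand is larger for \<open>s\<close> than for \<open>t\<close> by at least as much\<close>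
    have "\<delta> t \<le> \<delta> s" if t: "t \<le> s" for t
    proof -
      have "(\<Sum>j=t..s. \<alpha> j * d j) = (\<Sum>j=t..<s. \<alpha> j * d j) + \<alpha> s * d s"
        using t by (simp add: sum.last_plus add.commute)
      moreover have "(\<Sum>j=t..<s. \<alpha> j * d j) + d t \<le> d s"
        by (rule sum_digits_below[OF ds digits t order_refl])
      moreover obtain m where m: "CARD('n) - 1 = Suc m"
        using card by (cases "CARD('n) - 1") auto
      moreover have "d t - 1 \<le> d s - 1" "0 < d t"
        using sum_digits_below[OF ds digits t order_refl] d_sequence_pos[OF ds t] by auto
      moreover from this have "m * (d t - 1) \<le> m * (d s - 1)"
        by (rule_tac mult_le_mono2)
      ultimately show ?thesis
        unfolding \<delta>_s unfolding \<delta>_def m mult_Suc by linarith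
    qed
    moreover have "\<delta> s \<in> E"
      unfolding E using that by auto
    ultimately show ?thesis
      unfolding E by (auto intro!: Max_eqI)
  qed
  then show ?thesis
    using I_prod socle graded unfolding \<delta>_s unfolding E_def \<delta>_def Let_def by simp
qed

end
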